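(* Let $H$ be a Hilbert space, let $k>0$ be an integer, and let $X=\mathcal{E}^kH$ be the space of all empirical distributions of size $k$ in $H$ endowed with the $1$-Wasserstein distance. Then there is a Hilbert space $H'$ and a coarse embedding $\phi: X\to H'$.
   Context: Hilbert spaces are real. A map $f: X\to Y$ between metric spaces is a coarse embedding if there are non-decreasing functions $\rho_-,\rho_+:[0,\infty)\to[0,\infty)$ with $\lim_{t\to\infty}\rho_-(t)=\infty$ such that $\rho_-(d(x,x'))\le d(f(x),f(x'))\le \rho_+(d(x,x'))$ for all $x,x'\in X$. For a metric space $Y$, an empirical measure (or distribution) of size $k$ on $Y$ is a measure of the form $\frac1k\sum_{i=1}^k\delta_{x_i}$ with $x_1,\dots,x_k\in Y$ (not necessarily distinct). $\mathcal{E}^kY$ is the set of empirical measures of size $k$ on $Y$ with the $1$-Wasserstein distance, which for $\alpha=\frac1k\sum_{i=1}^k\delta_{x_i}$ and $\beta=\frac1k\sum_{i=1}^k\delta_{y_i}$ is $W_1(\alpha,\beta)=\frac1k\min_\pi\sum_{i=1}^k d(x_i,y_{\pi(i)})$, where $\pi$ ranges over all bijections $\{1,\dots,k\}\to\{1,\dots,k\}$. *)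

theory Defs
  imports
    "HOL-Analysis.Analysis"
    "HOL-Probability.Probability_Mass_Function"
    "HOL-Algebra.Module"
begin

section \<open>Coarse embeddings\<close>

definition coarse_embedding :: "'a metric \<Rightarrow> 'b metric \<Rightarrow> ('a \<Rightarrow> 'b) \<Rightarrow> bool" where
  "coarse_embedding X Y f \<longleftrightarrow>
     f \<in> mspace X \<rightarrow> mspace Y \<and>
     (\<exists>\<rho>\<^sub>m \<rho>\<^sub>p :: real \<Rightarrow> real.
        \<rho>\<^sub>m \<in> {0..} \<rightarrow> {0..} \<and> \<rho>\<^sub>p \<in> {0..} \<rightarrow> {0..} \<and>
        mono_on {0..} \<rho>\<^sub>m \<and> mono_on {0..} \<rho>\<^sub>p \<and>
        filterlim \<rho>\<^sub>m at_top at_top \<and>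
        (\<forall>x\<in>mspace X. \<forall>x'\<in>mspace X.
           \<rho>\<^sub>m (mdist X x x') \<le> mdist Y (f x) (f x') \<and>
           mdist Y (f x) (f x') \<le> \<rho>\<^sub>p (mdist X x x')))"


section \<open>Empirical measures and the 1-Wasserstein distance\<close>

text \<open>The points are indexed by \<open>0, \<dots>, k - 1\<close>; values of \<open>x\<close> at other indices are irrelevant.
  Lemma \<open>measure_empirical\<close> shows that this is \<open>(1/k) \<Sum> \<delta>\<^sub>x\<^sub>i\<close>.\<close>

definition empirical :: "nat \<Rightarrow> (nat \<Rightarrow> 'a) \<Rightarrow> 'a pmf" where
  "empirical k x = map_pmf x (pmf_of_set {..<k})"

definition empirical_measures :: "nat \<Rightarrow> 'a pmf set" where
  "empirical_measures k = range (empirical k)"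

definition matching_cost :: "nat \<Rightarrow> (nat \<Rightarrow> 'a::metric_space) \<Rightarrow> (nat \<Rightarrow> 'a) \<Rightarrow> real" where
  "matching_cost k x y =
     (MIN \<pi>\<in>{\<pi>. \<pi> permutes {..<k}}. \<Sum>i<k. dist (x i) (y (\<pi> i))) / real k"

text \<open>The cost is independent of the chosen representing tuples; see \<open>wasserstein1_empirical\<close>.\<close>

definition wasserstein1 :: "nat \<Rightarrow> 'a::metric_space pmf \<Rightarrow> 'a pmf \<Rightarrow> real" where
  "wasserstein1 k \<alpha> \<beta> =
     matching_cost k (SOME x. empirical k x = \<alpha>) (SOME y. empirical k y = \<beta>)"

definition empirical_space :: "nat \<Rightarrow> 'a::metric_space pmf metric" where
  "empirical_space k = metric (empirical_measures k, wasserstein1 k)"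

lemma measure_empirical:
  assumes "k > 0"
  shows "measure (measure_pmf (empirical k x)) A
           = (1 / real k) * (\<Sum>i<k. measure (return (count_space UNIV) (x i)) A)"
proof -
  have "measure (measure_pmf (empirical k x)) A = real (card ({..<k} \<inter> x -` A)) / real k"
    using assms by (simp add: empirical_def measure_pmf_of_set lessThan_empty_iff)
  also have "real (card ({..<k} \<inter> x -` A)) = (\<Sum>i<k. indicator A (x i))"
    by (simp add: indicator_def sum.If_cases vimage_def)
  finally show ?thesis
    by (simp add: measure_return)
qed

lemma empirical_eq_imp_permutes:
  assumes k: "k > 0" and eq: "empirical k x = empirical k y"
  obtains p where "p permutes {..<k}" "\<And>i. i < k \<Longrightarrow> x i = y (p i)"
proof -
  have "card ({..<k} \<inter> x -` {a}) = card ({..<k} \<inter> y -` {a})" for a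
  proof -
    have "measure (measure_pmf (empirical k z)) {a} = real (card ({..<k} \<inter> z -` {a})) / real k"
      for z :: "nat \<Rightarrow> 'a"
      using k by (simp add: empirical_def measure_pmf_of_set lessThan_empty_iff)
    from this[of x] this[of y] show ?thesis
      using eq k by simp
  qed
  then have "image_mset x (mset_set {..<k}) = image_mset y (mset_set {..<k})"
    by (intro multiset_eqI) (simp add: count_image_mset vimage_def Int_def conj_commute)
  from image_mset_eq_implies_permutes[OF finite_lessThan this]
  obtain p where "p permutes {..<k}" "\<forall>i\<in>{..<k}. x i = y (p i)" .
  then show thesis
    using that by auto
qed

lemma matching_cost_le:
  assumes "p permutes {..<k}"
  shows "matching_cost k x y \<le> (\<Sum>i<k. dist (x i) (y (p i))) / real k"
  unfolding matching_cost_def using assms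
  by (intro divide_right_mono Min_le) (auto simp: finite_permutations)

lemma matching_cost_attained:
  obtains p where "p permutes {..<k}"
    "matching_cost k x y = (\<Sum>i<k. dist (x i) (y (p i))) / real k"
proof -
  let ?S = "(\<lambda>\<pi>. \<Sum>i<k. dist (x i) (y (\<pi> i))) ` {\<pi>. \<pi> permutes {..<k}}"
  have "Min ?S \<in> ?S"
  proof (rule Min_in)
    show "finite ?S"
      by (simp add: finite_permutations)
    show "?S \<noteq> {}"
      using permutes_id[of "{..<k}"] by blast
  qed
  then show thesis
    using that unfolding matching_cost_def by auto
qed

lemma matching_cost_nonneg: "0 \<le> matching_cost k x y"
  by (rule matching_cost_attained[of k x y]) (simp add: sum_nonneg)

lemma matching_cost_commute_le: "matching_cost k x y \<le> matching_cost k y x"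
proof -
  obtain p where p: "p permutes {..<k}"
    and eq: "matching_cost k y x = (\<Sum>i<k. dist (y i) (x (p i))) / real k"
    by (rule matching_cost_attained)
  have "(\<Sum>i<k. dist (y i) (x (p i))) = (\<Sum>i<k. dist (y (inv_into UNIV p i)) (x (p (inv_into UNIV p i))))"
    using sum.permute[OF permutes_inv[OF p], of "\<lambda>i. dist (y i) (x (p i))"] by (simp add: o_def)
  also have "\<dots> = (\<Sum>i<k. dist (x i) (y (inv_into UNIV p i)))"
    using p by (simp add: permutes_inverses dist_commute)
  finally show ?thesis
    using matching_cost_le[OF permutes_inv[OF p], of x y] eq by simp
qed

lemma matching_cost_commute: "matching_cost k x y = matching_cost k y x"
  using matching_cost_commute_le by (metis order_antisym)

lemma matching_cost_triangle:
  "matching_cost k x z \<le> matching_cost k x y + matching_cost k y z"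
proof -
  obtain p where p: "p permutes {..<k}"
    and xy: "matching_cost k x y = (\<Sum>i<k. dist (x i) (y (p i))) / real k"
    by (rule matching_cost_attained)
  obtain q where q: "q permutes {..<k}"
    and yz: "matching_cost k y z = (\<Sum>i<k. dist (y i) (z (q i))) / real k"
    by (rule matching_cost_attained)
  have "(\<Sum>i<k. dist (x i) (z ((q \<circ> p) i)))
      \<le> (\<Sum>i<k. dist (x i) (y (p i)) + dist (y (p i)) (z (q (p i))))"
    by (intro sum_mono) (simp add: dist_triangle)
  also have "\<dots> = (\<Sum>i<k. dist (x i) (y (p i))) + (\<Sum>i<k. dist (y i) (z (q i)))"
    using sum.permute[OF p, of "\<lambda>i. dist (y i) (z (q i))"] by (simp add: sum.distrib o_def)
  finally have "(\<Sum>i<k. dist (x i) (z ((q \<circ> p) i))) / real k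
      \<le> ((\<Sum>i<k. dist (x i) (y (p i))) + (\<Sum>i<k. dist (y i) (z (q i)))) / real k"
    by (rule divide_right_mono) simp
  then show ?thesis
    using matching_cost_le[OF permutes_compose[OF p q], of x z]
    unfolding xy yz add_divide_distrib by (rule order_trans[rotated])
qed

lemma matching_cost_eq_0_iff:
  assumes k: "k > 0"
  shows "matching_cost k x y = 0 \<longleftrightarrow> empirical k x = empirical k y"
proof
  assume 0: "matching_cost k x y = 0"
  obtain p where p: "p permutes {..<k}"
    and "matching_cost k x y = (\<Sum>i<k. dist (x i) (y (p i))) / real k"
    by (rule matching_cost_attained)
  with 0 k have "(\<Sum>i<k. dist (x i) (y (p i))) = 0"
    by simp
  then have xy: "x i = y (p i)" if "i < k" for i
    using that by (simp add: sum_nonneg_eq_0_iff)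
  have ne: "{..<k} \<noteq> {}"
    using k by (simp add: lessThan_empty_iff)
  have "empirical k x = map_pmf (y \<circ> p) (pmf_of_set {..<k})"
    unfolding empirical_def using xy ne by (intro map_pmf_cong) (auto simp: set_pmf_of_set)
  also have "\<dots> = map_pmf y (map_pmf p (pmf_of_set {..<k}))"
    by (simp add: map_pmf_comp o_def)
  also have "map_pmf p (pmf_of_set {..<k}) = pmf_of_set {..<k}"
    using p ne by (subst map_pmf_of_set_inj) (auto simp: permutes_inj_on permutes_image)
  finally show "empirical k x = empirical k y"
    by (simp add: empirical_def)
next
  assume "empirical k x = empirical k y"
  then obtain p where p: "p permutes {..<k}" "\<And>i. i < k \<Longrightarrow> x i = y (p i)"
    using empirical_eq_imp_permutes[OF k] by metis
  then have "matching_cost k x y \<le> 0"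
    using matching_cost_le[OF p(1), of x y] by simp
  with matching_cost_nonneg[of k x y] show "matching_cost k x y = 0"
    by simp
qed

lemma matching_cost_cong:
  assumes k: "k > 0"
    and "empirical k x = empirical k x'" "empirical k y = empirical k y'"
  shows "matching_cost k x y = matching_cost k x' y'"
proof -
  have "matching_cost k x x' = 0" "matching_cost k x' x = 0"
    "matching_cost k y y' = 0" "matching_cost k y' y = 0"
    using assms by (simp_all add: matching_cost_eq_0_iff)
  then show ?thesis
    using matching_cost_triangle[of k x y x'] matching_cost_triangle[of k x' y y']
      matching_cost_triangle[of k x' y' x] matching_cost_triangle[of k x y' y]
    by linarith
qed

lemma wasserstein1_empirical:
  assumes "k > 0"
  shows "wasserstein1 k (empirical k x) (empirical k y) = matching_cost k x y"
proof -
  have "empirical k (SOME x'. empirical k x' = empirical k z) = empirical k z" for z :: "nat \<Rightarrow> 'a"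
    by (rule someI[where P = "\<lambda>x'. empirical k x' = empirical k z" and x = z]) (rule refl)
  then show ?thesis
    unfolding wasserstein1_def by (intro matching_cost_cong[OF assms])
qed

lemma Metric_space_empirical:
  assumes "k > 0"
  shows "Metric_space (empirical_measures k) (wasserstein1 k)"
proof
  show "0 \<le> wasserstein1 k \<alpha> \<beta>" for \<alpha> \<beta> :: "'a pmf"
    by (simp add: wasserstein1_def matching_cost_nonneg)
  show "wasserstein1 k \<alpha> \<beta> = wasserstein1 k \<beta> \<alpha>" for \<alpha> \<beta> :: "'a pmf"
    unfolding wasserstein1_def by (rule matching_cost_commute)
  show "wasserstein1 k \<alpha> \<beta> = 0 \<longleftrightarrow> \<alpha> = \<beta>"
    if "\<alpha> \<in> empirical_measures k" "\<beta> \<in> empirical_measures k" for \<alpha> \<beta> :: "'a pmf"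
    using that assms
    by (auto simp: empirical_measures_def wasserstein1_empirical matching_cost_eq_0_iff)
  show "wasserstein1 k \<alpha> \<gamma> \<le> wasserstein1 k \<alpha> \<beta> + wasserstein1 k \<beta> \<gamma>"
    for \<alpha> \<beta> \<gamma> :: "'a pmf"
    unfolding wasserstein1_def by (rule matching_cost_triangle)
qed

lemma mspace_empirical_space: "k > 0 \<Longrightarrow> mspace (empirical_space k) = empirical_measures k"
  and mdist_empirical_space: "k > 0 \<Longrightarrow> mdist (empirical_space k) = wasserstein1 k"
  by (simp_all add: empirical_space_def Metric_space.mspace_metric Metric_space.mdist_metric
      Metric_space_empirical)


section \<open>Real Hilbert spaces on explicit carriers\<close>

text \<open>A type class cannot occur under an existential quantifier, so a Hilbert space whose existence
  is asserted is a real vector space on a carrier set together with an inner product.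
  Lemma \<open>real_hilbert_space_UNIV\<close> relates this to the type classes.
  The ring multiplication and unit that the record \<open>module\<close> inherits play no role.\<close>

definition real_field :: "real ring" where
  "real_field = \<lparr>carrier = UNIV, mult = (*), one = 1, zero = 0, add = (+)\<rparr>"

definition ip_metric :: "('c, 'v) module \<Rightarrow> ('v \<Rightarrow> 'v \<Rightarrow> real) \<Rightarrow> 'v metric" where
  "ip_metric V ip = metric (carrier V, \<lambda>x y.
     if x \<in> carrier V \<and> y \<in> carrier V then sqrt (ip (x \<ominus>\<^bsub>V\<^esub> y) (x \<ominus>\<^bsub>V\<^esub> y)) else 0)"

locale real_inner_product_space = Module.module real_field V for V :: "(real, 'v) module" (structure) +
  fixes ip :: "'v \<Rightarrow> 'v \<Rightarrow> real"
  assumes ip_commute: "\<lbrakk>x \<in> carrier V; y \<in> carrier V\<rbrakk> \<Longrightarrow> ip x y = ip y x"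
    and ip_add: "\<lbrakk>x \<in> carrier V; y \<in> carrier V; z \<in> carrier V\<rbrakk>
      \<Longrightarrow> ip (x \<oplus> y) z = ip x z + ip y z"
    and ip_smult: "\<lbrakk>x \<in> carrier V; y \<in> carrier V\<rbrakk> \<Longrightarrow> ip (a \<odot>\<^bsub>V\<^esub> x) y = a * ip x y"
    and ip_nonneg: "x \<in> carrier V \<Longrightarrow> 0 \<le> ip x x"
    and ip_eq_0: "x \<in> carrier V \<Longrightarrow> ip x x = 0 \<Longrightarrow> x = \<zero>"

locale real_hilbert_space = real_inner_product_space +
  assumes complete: "mcomplete_of (ip_metric V ip)"

text \<open>The carrier of the Hilbert space asserted to exist must live in a fixed type. For maps defined
  on a set \<open>X\<close> of points of type \<open>'x\<close>, the type \<open>'x \<Rightarrow> real\<close> is large enough: given \<open>\<phi>\<close> from \<open>X\<close>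
  to any Hilbert space, the closed linear span of \<open>\<phi> ` X\<close> is a Hilbert space with the same distances
  and is mapped injectively and linearly into \<open>'x \<Rightarrow> real\<close> by
  \<open>v \<mapsto> (\<lambda>x. if x \<in> X then \<langle>v, \<phi> x\<rangle> else 0)\<close>.\<close>

context real_inner_product_space
begin

lemma carrier_real_field: "carrier real_field = UNIV"
  by (simp add: real_field_def)

lemma minus_closed_V: "\<lbrakk>x \<in> carrier V; y \<in> carrier V\<rbrakk> \<Longrightarrow> x \<ominus> y \<in> carrier V"
  by (rule M.minus_closed)

lemma smult_closed_V: "x \<in> carrier V \<Longrightarrow> a \<odot>\<^bsub>V\<^esub> x \<in> carrier V"
  by (simp add: carrier_real_field)

lemma ip_add_right: "\<lbrakk>x \<in> carrier V; y \<in> carrier V; z \<in> carrier V\<rbrakk>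
    \<Longrightarrow> ip z (x \<oplus> y) = ip z x + ip z y"
  by (simp add: ip_commute[of z] ip_add)

lemma ip_smult_right: "\<lbrakk>x \<in> carrier V; y \<in> carrier V\<rbrakk> \<Longrightarrow> ip x (a \<odot>\<^bsub>V\<^esub> y) = a * ip x y"
  using ip_smult[of y x a] by (simp add: ip_commute[of x] smult_closed_V)

lemma ip_zero_left: "x \<in> carrier V \<Longrightarrow> ip \<zero> x = 0"
  using ip_add[of \<zero> \<zero> x] by simp

lemma ip_a_inv_left:
  assumes "x \<in> carrier V" "y \<in> carrier V"
  shows "ip (\<ominus> x) y = - ip x y"
  using ip_add[of x "\<ominus> x" y] assms by (simp add: M.r_neg ip_zero_left)

lemma ip_a_inv_both: "x \<in> carrier V \<Longrightarrow> ip (\<ominus> x) (\<ominus> x) = ip x x"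
  by (simp add: ip_a_inv_left ip_commute[of x "\<ominus> x"])

lemma ip_Cauchy_Schwarz:
  assumes x: "x \<in> carrier V" and y: "y \<in> carrier V"
  shows "ip x y \<le> sqrt (ip x x) * sqrt (ip y y)"
proof (cases "ip y y = 0")
  case True
  then have "y = \<zero>"
    by (simp add: y ip_eq_0)
  then have "ip x y = 0"
    using x by (simp add: ip_commute[of x] ip_zero_left)
  then show ?thesis
    using True by simp
next
  case False
  with ip_nonneg[OF y] have pos: "ip y y > 0"
    by simp
  define c where "c = - (ip x y / ip y y)"
  have "0 \<le> ip (x \<oplus> c \<odot>\<^bsub>V\<^esub> y) (x \<oplus> c \<odot>\<^bsub>V\<^esub> y)"
    using x y by (intro ip_nonneg) (simp add: smult_closed_V)
  also have "\<dots> = ip x x + 2 * c * ip x y + c\<^sup>2 * ip y y"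
    using x y by (simp add: smult_closed_V ip_add ip_add_right ip_smult ip_smult_right
        ip_commute[of y x] power2_eq_square algebra_simps)
  also have "\<dots> = ip x x - (ip x y)\<^sup>2 / ip y y"
    using pos by (simp add: c_def power2_eq_square field_simps)
  finally have "(ip x y)\<^sup>2 \<le> ip x x * ip y y"
    using pos by (simp add: field_simps)
  then show ?thesis
    by (metis real_le_rsqrt real_sqrt_mult)
qed

lemma Metric_space_ip:
  "Metric_space (carrier V) (\<lambda>x y.
     if x \<in> carrier V \<and> y \<in> carrier V then sqrt (ip (x \<ominus> y) (x \<ominus> y)) else 0)"
  (is "Metric_space _ ?d")
proof
  show "0 \<le> ?d x y" for x y
    by (simp add: ip_nonneg)
  show "?d x y = ?d y x" for x y
  proof (cases "x \<in> carrier V \<and> y \<in> carrier V")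
    case True
    then have "y \<ominus> x = \<ominus> (x \<ominus> y)"
      by (simp add: a_minus_def M.minus_add M.a_comm)
    with True show ?thesis
      by (simp add: ip_a_inv_both)
  qed auto
  show "?d x y = 0 \<longleftrightarrow> x = y" if x: "x \<in> carrier V" and y: "y \<in> carrier V" for x y
  proof
    assume "?d x y = 0"
    then have "x \<ominus> y = \<zero>"
      using x y by (intro ip_eq_0) simp_all
    then have "\<ominus> (\<ominus> y) = x"
      using x y by (intro M.minus_equality) (simp_all add: a_minus_def)
    then show "x = y"
      using y by simp
  next
    assume "x = y"
    then show "?d x y = 0"
      using x y by (simp add: ip_zero_left a_minus_def M.r_neg)
  qed
  show "?d x z \<le> ?d x y + ?d y z"
    if x: "x \<in> carrier V" and y: "y \<in> carrier V" and z: "z \<in> carrier V" for x y z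
  proof -
    define u v where "u = x \<ominus> y" and "v = y \<ominus> z"
    have u: "u \<in> carrier V" and v: "v \<in> carrier V"
      using x y z by (simp_all add: u_def v_def)
    have xz: "x \<ominus> z = u \<oplus> v"
      using x y z by (simp add: u_def v_def a_minus_def M.a_ac M.r_neg1 M.r_neg2)
    have "ip (u \<oplus> v) (u \<oplus> v) = ip u u + 2 * ip u v + ip v v"
      using u v by (simp add: ip_add ip_add_right ip_commute[of v u])
    also have "\<dots> \<le> (sqrt (ip u u) + sqrt (ip v v))\<^sup>2"
      using u v ip_Cauchy_Schwarz[OF u v] by (simp add: power2_sum ip_nonneg)
    finally have "sqrt (ip (u \<oplus> v) (u \<oplus> v)) \<le> sqrt (ip u u) + sqrt (ip v v)"
      using u v by (intro real_le_lsqrt) (simp_all add: ip_nonneg)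
    then show ?thesis
      using x y z xz by (simp add: u_def v_def)
  qed
qed

lemma mspace_ip_metric: "mspace (ip_metric V ip) = carrier V"
  unfolding ip_metric_def by (rule Metric_space.mspace_metric[OF Metric_space_ip])

lemma mdist_ip_metric: "\<lbrakk>x \<in> carrier V; y \<in> carrier V\<rbrakk>
    \<Longrightarrow> mdist (ip_metric V ip) x y = sqrt (ip (x \<ominus> y) (x \<ominus> y))"
  unfolding ip_metric_def Metric_space.mdist_metric[OF Metric_space_ip] by simp

end

definition type_module :: "(real, 'v::real_vector) module" where
  "type_module = \<lparr>carrier = UNIV, mult = undefined, one = undefined,
     zero = 0, add = (+), smult = (*\<^sub>R)\<rparr>"

lemma cring_real_field: "cring real_field"
proof (rule cringI)
  show "abelian_group real_field"
  proof (rule abelian_groupI)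
    show "\<exists>y\<in>carrier real_field. y \<oplus>\<^bsub>real_field\<^esub> x = \<zero>\<^bsub>real_field\<^esub>" for x
      by (auto simp: real_field_def intro: exI[of _ "- x"])
  qed (auto simp: real_field_def)
  show "Group.comm_monoid real_field"
    by (rule comm_monoidI) (auto simp: real_field_def)
qed (auto simp: real_field_def algebra_simps)

lemma module_type_module: "Module.module real_field (type_module :: (real, 'v::real_vector) module)"
proof (rule Module.moduleI[OF cring_real_field])
  show "abelian_group (type_module :: (real, 'v) module)"
  proof (rule abelian_groupI)
    show "\<exists>y\<in>carrier type_module. y \<oplus>\<^bsub>type_module\<^esub> x = \<zero>\<^bsub>type_module\<^esub>" for x :: 'v
      by (auto simp: type_module_def intro: exI[of _ "- x"])
  qed (auto simp: type_module_def)
qed (auto simp: type_module_def real_field_def scaleR_add_left scaleR_add_right)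

lemma real_inner_product_space_UNIV:
  "real_inner_product_space (type_module :: (real, 'v::real_inner) module) (\<bullet>)"
  by (intro real_inner_product_space.intro real_inner_product_space_axioms.intro module_type_module)
     (auto simp: type_module_def inner_commute inner_add_left inner_add_right)

lemma ip_metric_UNIV:
  "ip_metric (type_module :: (real, 'v::real_inner) module) (\<bullet>) = metric (UNIV, dist)"
proof -
  interpret real_inner_product_space "type_module :: (real, 'v) module" "(\<bullet>)"
    by (rule real_inner_product_space_UNIV)
  have car: "carrier (type_module :: (real, 'v) module) = UNIV"
    by (simp add: type_module_def)
  have "x \<ominus>\<^bsub>type_module\<^esub> y = x - y" for x y :: 'v
  proof -
    have "(x - y) \<oplus>\<^bsub>type_module\<^esub> y = x"
      by (simp add: type_module_def)
    then show ?thesis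
      by (metis M.add.inv_solve_right' UNIV_I a_minus_def car)
  qed
  then have "(\<lambda>x y. if x \<in> carrier (type_module :: (real, 'v) module) \<and> y \<in> carrier type_module
      then sqrt ((x \<ominus>\<^bsub>type_module\<^esub> y) \<bullet> (x \<ominus>\<^bsub>type_module\<^esub> y)) else 0) = dist"
    by (intro ext) (simp add: car dist_norm norm_eq_sqrt_inner)
  then show ?thesis
    unfolding ip_metric_def car by simp
qed

lemma real_hilbert_space_UNIV:
  "real_hilbert_space (type_module :: (real, 'v::{real_inner, complete_space}) module) (\<bullet>)"
proof (intro real_hilbert_space.intro real_hilbert_space_axioms.intro)
  show "mcomplete_of (ip_metric (type_module :: (real, 'v) module) (\<bullet>))"
    unfolding ip_metric_UNIV Met_TC.mcomplete_of mcomplete_iff_complete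
    by (rule complete_UNIV)
qed (rule real_inner_product_space_UNIV)

end

theory Submission
  imports Defs
begin

text \<open>Compare two \<open>k\<close>-tuples through the Gaussian kernels \<open>exp (-t |u - v|\<^sup>2)\<close>: let \<open>Q\<^sub>t\<close> be the squared
  distance between the sums of the feature vectors of their points. The squared distance of the embedding is
  \<open>D = \<Sum>\<^sub>m Q\<^sub>t\<close> over \<open>t = 1 / (L (L\<^sup>m)\<^sup>2)\<close>, where \<open>L = 8k\<^sup>2\<close>. Along an optimal
  matching, \<open>Q\<^sub>t \<le> 2 t k\<^sup>3 W\<^sup>2\<close>, so the sum converges and \<open>D\<close> is at most a constant times \<open>W\<^sup>2\<close>, with
  \<open>W\<close> the Wasserstein distance.
  Conversely, if no distance between two of the points lies between \<open>L\<^sup>m\<close> and \<open>L\<^sup>m\<^sup>+\<^sup>1\<close>, then at scale \<open>m\<close> the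
  points split into clusters on which the kernel is almost \<open>1\<close> while it almost vanishes between different clusters;
  if moreover \<open>W > L\<^sup>m\<close>, some cluster contains different numbers of points of the two tuples, whence
  \<open>Q\<^sub>t \<ge> 1/2\<close>. All but \<open>4k\<^sup>2\<close> of the scales with \<open>L\<^sup>m < W\<close> qualify, so \<open>D\<close> grows at least like
  \<open>log W\<close>.\<close>

section \<open>The Hilbert space of square-summable functions\<close>

text \<open>The index type is arbitrary, since the embedding needs a coordinate for every list of
  basis vectors; \<open>summable_on\<close> is unordered summability and allows uncountably
  many.\<close>

definition l2_module :: "(real, 'j \<Rightarrow> real) module" where
  "l2_module = \<lparr>carrier = {f. (\<lambda>j. (f j)\<^sup>2) summable_on UNIV}, mult = undefined, one = undefined,
     zero = (\<lambda>_. 0), add = (\<lambda>f g j. f j + g j), smult = (\<lambda>a f j. a * f j)\<rparr>"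

definition l2_inner :: "('j \<Rightarrow> real) \<Rightarrow> ('j \<Rightarrow> real) \<Rightarrow> real" where
  "l2_inner f g = (\<Sum>\<^sub>\<infinity>j. f j * g j)"

text \<open>\<open>infsum\<close> is 0 on a family that is not summable, so additivity of
  \<open>l2_inner\<close> depends on this Cauchy-Schwarz type fact.\<close>

lemma summable_on_mult_of_squares:
  fixes f g :: "'i \<Rightarrow> real"
  assumes "(\<lambda>i. (f i)\<^sup>2) summable_on I" "(\<lambda>i. (g i)\<^sup>2) summable_on I"
  shows "(\<lambda>i. f i * g i) summable_on I"
  using assms[THEN summable_on_iff_abs_summable_on_real[THEN iffD1]] unfolding power2_eq_square
  by (intro abs_summable_summable[OF abs_summable_product])

lemma summable_on_add_squared:
  fixes f g :: "'i \<Rightarrow> real"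
  assumes "(\<lambda>i. (f i)\<^sup>2) summable_on I" "(\<lambda>i. (g i)\<^sup>2) summable_on I"
  shows "(\<lambda>i. (f i + g i)\<^sup>2) summable_on I"
proof -
  have "(\<lambda>i. (f i)\<^sup>2 + (g i)\<^sup>2 + 2 * (f i * g i)) summable_on I"
    by (intro summable_on_add summable_on_cmult_right summable_on_mult_of_squares assms)
  then show ?thesis
    by (simp add: power2_sum mult.assoc)
qed

lemma summable_on_smult_squared:
  fixes f :: "'i \<Rightarrow> real"
  assumes "(\<lambda>i. (f i)\<^sup>2) summable_on I"
  shows "(\<lambda>i. (a * f i)\<^sup>2) summable_on I"
  using summable_on_cmult_right[OF assms, of "a\<^sup>2"] by (simp add: power_mult_distrib)

lemma l2_module_simps [simp]:
  "f \<in> carrier l2_module \<longleftrightarrow> (\<lambda>j. (f j)\<^sup>2) summable_on UNIV"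
  "\<zero>\<^bsub>l2_module\<^esub> = (\<lambda>_. 0)"
  "f \<oplus>\<^bsub>l2_module\<^esub> g = (\<lambda>j. f j + g j)"
  "a \<odot>\<^bsub>l2_module\<^esub> f = (\<lambda>j. a * f j)"
  by (simp_all add: l2_module_def)

lemma real_inner_product_space_l2:
  "real_inner_product_space (l2_module :: (real, 'j \<Rightarrow> real) module) l2_inner"
proof (intro real_inner_product_space.intro real_inner_product_space_axioms.intro
    Module.moduleI cring_real_field)
  let ?V = "l2_module :: (real, 'j \<Rightarrow> real) module"
  show "abelian_group ?V"
  proof (rule abelian_groupI)
    show "\<exists>g\<in>carrier ?V. g \<oplus>\<^bsub>?V\<^esub> f = \<zero>\<^bsub>?V\<^esub>" if "f \<in> carrier ?V" for f
      using that by (intro bexI[of _ "\<lambda>j. - f j"]) (auto simp: fun_eq_iff)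
  qed (auto simp: summable_on_add_squared fun_eq_iff)
next
  let ?V = "l2_module :: (real, 'j \<Rightarrow> real) module"
  show "l2_inner f g = l2_inner g f" for f g :: "'j \<Rightarrow> real"
    by (simp add: l2_inner_def mult.commute)
  show "l2_inner (f \<oplus>\<^bsub>?V\<^esub> g) h = l2_inner f h + l2_inner g h"
    if "f \<in> carrier ?V" "g \<in> carrier ?V" "h \<in> carrier ?V" for f g h
    unfolding l2_inner_def l2_module_simps distrib_right using that
    by (intro infsum_add summable_on_mult_of_squares) auto
  show "l2_inner (a \<odot>\<^bsub>?V\<^esub> f) g = a * l2_inner f g" for a f g
    by (simp only: l2_inner_def l2_module_simps mult.assoc infsum_cmult_right')
  show "0 \<le> l2_inner f f" for f :: "'j \<Rightarrow> real"
    by (simp add: l2_inner_def infsum_nonneg)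
  show "f = \<zero>\<^bsub>?V\<^esub>" if "f \<in> carrier ?V" "l2_inner f f = 0" for f
  proof
    fix j
    have "(f j)\<^sup>2 = 0"
      using that by (intro nonneg_infsum_le_0D[where A = UNIV and f = "\<lambda>j. (f j)\<^sup>2"])
        (auto simp: l2_inner_def power2_eq_square)
    then show "f j = \<zero>\<^bsub>?V\<^esub> j"
      by simp
  qed
qed (auto simp: summable_on_smult_squared real_field_def algebra_simps fun_eq_iff simp del: power_mult_distrib)

lemma mspace_l2: "mspace (ip_metric l2_module l2_inner) = carrier l2_module"
  by (rule real_inner_product_space.mspace_ip_metric[OF real_inner_product_space_l2])

lemma mdist_l2:
  assumes "f \<in> carrier l2_module" "g \<in> carrier l2_module"
  shows "mdist (ip_metric l2_module l2_inner) f g = sqrt (\<Sum>\<^sub>\<infinity>j. (f j - g j)\<^sup>2)"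
proof -
  interpret real_inner_product_space l2_module l2_inner
    by (rule real_inner_product_space_l2)
  have diff: "(\<lambda>j. f j - g j) \<in> carrier l2_module"
    using assms summable_on_add_squared[of f UNIV "\<lambda>j. - g j"] by simp
  have "(\<lambda>j. f j - g j) \<oplus>\<^bsub>l2_module\<^esub> g = f"
    by simp
  then have "f \<ominus>\<^bsub>l2_module\<^esub> g = (\<lambda>j. f j - g j)"
    unfolding a_minus_def by (intro M.add.inv_solve_right'[THEN iffD2, OF diff assms]) simp
  then show ?thesis
    using mdist_ip_metric[OF assms] by (simp add: l2_inner_def power2_eq_square)
qed

lemma l2_diff_summable:
  fixes f g :: "'i \<Rightarrow> real"
  assumes "(\<lambda>i. (f i)\<^sup>2) summable_on I" "(\<lambda>i. (g i)\<^sup>2) summable_on I"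
  shows "(\<lambda>i. (f i - g i)\<^sup>2) summable_on I"
  using summable_on_add_squared[of f I "\<lambda>i. - g i"] assms by simp

text \<open>A Cauchy sequence converges in each coordinate, because a coordinate difference is at
  most the distance. Bounds on finite partial sums survive the coordinatewise limit and, being
  uniform in the finite set, bound the whole series.\<close>

lemma real_hilbert_space_l2:
  "real_hilbert_space (l2_module :: (real, 'j \<Rightarrow> real) module) l2_inner"
proof (intro real_hilbert_space.intro real_hilbert_space_axioms.intro real_inner_product_space_l2)
  let ?V = "l2_module :: (real, 'j \<Rightarrow> real) module"
  let ?m = "ip_metric ?V l2_inner"
  interpret real_inner_product_space ?V l2_inner
    by (rule real_inner_product_space_l2)
  interpret D: Metric_space "mspace ?m" "mdist ?m"
    by (rule Metric_space_mspace_mdist)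
  show "mcomplete_of ?m"
    unfolding mcomplete_of_def D.mcomplete_def
  proof (intro allI impI)
    fix \<sigma> assume "D.MCauchy \<sigma>"
    then have \<sigma>: "\<sigma> n \<in> carrier ?V" for n
      unfolding D.MCauchy_def by (auto simp: mspace_l2 simp del: l2_module_simps)
    have Cauchy: "\<exists>N. \<forall>n n'. N \<le> n \<longrightarrow> N \<le> n' \<longrightarrow> mdist ?m (\<sigma> n) (\<sigma> n') < e" if "e > 0" for e
      using that \<open>D.MCauchy \<sigma>\<close> unfolding D.MCauchy_def by auto
    have finite_bound: "(\<Sum>j\<in>F. (\<sigma> n j - \<sigma> m j)\<^sup>2) \<le> (mdist ?m (\<sigma> n) (\<sigma> m))\<^sup>2"
      if "finite F" for F n m
    proof -
      have "(\<Sum>j\<in>F. (\<sigma> n j - \<sigma> m j)\<^sup>2) \<le> (\<Sum>\<^sub>\<infinity>j. (\<sigma> n j - \<sigma> m j)\<^sup>2)"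
        using that \<sigma> by (intro finite_sum_le_infsum l2_diff_summable) auto
      then show ?thesis
        using \<sigma> by (simp add: mdist_l2 infsum_nonneg del: l2_module_simps)
    qed
    define f where "f j = lim (\<lambda>n. \<sigma> n j)" for j
    have "Cauchy (\<lambda>n. \<sigma> n j)" for j
    proof (rule metric_CauchyI)
      fix e :: real assume "e > 0"
      then obtain N where N: "\<And>n n'. N \<le> n \<Longrightarrow> N \<le> n' \<Longrightarrow> mdist ?m (\<sigma> n) (\<sigma> n') < e"
        using Cauchy by meson
      show "\<exists>N. \<forall>m\<ge>N. \<forall>n\<ge>N. dist (\<sigma> m j) (\<sigma> n j) < e"
      proof (intro exI allI impI)
        fix m n assume "N \<le> m" "N \<le> n"
        then have "mdist ?m (\<sigma> m) (\<sigma> n) < e"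
          using N by auto
        moreover have "\<bar>\<sigma> m j - \<sigma> n j\<bar> \<le> mdist ?m (\<sigma> m) (\<sigma> n)"
          using finite_bound[of "{j}" m n] by (simp add: abs_le_square_iff[symmetric])
        ultimately show "dist (\<sigma> m j) (\<sigma> n j) < e"
          by (simp add: dist_real_def)
      qed
    qed
    then have f: "(\<lambda>n. \<sigma> n j) \<longlonglongrightarrow> f j" for j
      unfolding f_def by (intro convergent_LIMSEQ_iff[THEN iffD1] Cauchy_convergent)
    have tail: "\<exists>N. \<forall>n\<ge>N. (\<lambda>j. (\<sigma> n j - f j)\<^sup>2) summable_on UNIV \<and>
        (\<Sum>\<^sub>\<infinity>j. (\<sigma> n j - f j)\<^sup>2) \<le> e\<^sup>2" if "e > 0" for e
    proof -
      obtain N where N: "\<And>n n'. N \<le> n \<Longrightarrow> N \<le> n' \<Longrightarrow> mdist ?m (\<sigma> n) (\<sigma> n') < e"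
        using Cauchy[OF \<open>e > 0\<close>] by meson
      have *: "(\<Sum>j\<in>F. (\<sigma> n j - f j)\<^sup>2) \<le> e\<^sup>2" if "finite F" "n \<ge> N" for F n
      proof (rule tendsto_upperbound)
        show "(\<lambda>m. \<Sum>j\<in>F. (\<sigma> n j - \<sigma> m j)\<^sup>2) \<longlonglongrightarrow> (\<Sum>j\<in>F. (\<sigma> n j - f j)\<^sup>2)"
          by (intro tendsto_intros f)
        show "\<forall>\<^sub>F m in sequentially. (\<Sum>j\<in>F. (\<sigma> n j - \<sigma> m j)\<^sup>2) \<le> e\<^sup>2"
          using eventually_ge_at_top[of N]
        proof eventually_elim
          case (elim m)
          have "(mdist ?m (\<sigma> n) (\<sigma> m))\<^sup>2 \<le> e\<^sup>2"
            using N[OF \<open>n \<ge> N\<close> elim] by (intro power_mono) auto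
          with finite_bound[OF \<open>finite F\<close>, of n m] show ?case
            by linarith
        qed
      qed simp
      have "(\<lambda>j. (\<sigma> n j - f j)\<^sup>2) summable_on UNIV" if "n \<ge> N" for n
        using * that by (intro nonneg_bdd_above_summable_on bdd_aboveI2[where M = "e\<^sup>2"]) auto
      moreover from this have "(\<Sum>\<^sub>\<infinity>j. (\<sigma> n j - f j)\<^sup>2) \<le> e\<^sup>2" if "n \<ge> N" for n
        using * that by (intro infsum_le_finite_sums) auto
      ultimately show ?thesis
        by blast
    qed
    \<comment> \<open>\<open>f\<close> is \<open>\<sigma> n\<close> minus the square-summable
      difference \<open>\<sigma> n - f\<close>.\<close>
    have fV: "f \<in> carrier ?V"
    proof -
      obtain n where "(\<lambda>j. (\<sigma> n j - f j)\<^sup>2) summable_on UNIV"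
        using tail[of 1] by auto
      from l2_diff_summable[OF _ this, of "\<sigma> n"] \<sigma>[of n] show ?thesis
        by simp
    qed
    have "\<exists>N. \<forall>n\<ge>N. \<sigma> n \<in> carrier ?V \<and> mdist ?m (\<sigma> n) f < e" if "e > 0" for e
    proof -
      obtain N where N: "\<And>n. n \<ge> N \<Longrightarrow> (\<Sum>\<^sub>\<infinity>j. (\<sigma> n j - f j)\<^sup>2) \<le> (e / 2)\<^sup>2"
        using tail[of "e / 2"] \<open>e > 0\<close> by auto
      have "mdist ?m (\<sigma> n) f < e" if "n \<ge> N" for n
      proof -
        have "mdist ?m (\<sigma> n) f \<le> e / 2"
          using N[OF that] \<open>e > 0\<close> unfolding mdist_l2[OF \<sigma> fV]
          by (intro real_le_lsqrt) auto
        with \<open>e > 0\<close> show ?thesis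
          by simp
      qed
      with \<sigma> show ?thesis
        by blast
    qed
    with fV show "\<exists>f. limitin D.mtopology \<sigma> f sequentially"
      unfolding D.limit_metric_sequentially unfolding mspace_l2 by blast
  qed
qed

text \<open>The differences \<open>\<psi> x - \<psi> y\<close> are square-summable although the features \<open>\<psi> x\<close> need not be, so
  \<open>\<phi>\<close> subtracts the features of a base point.\<close>

lemma l2_embedding_of_features:
  fixes \<psi> :: "'x \<Rightarrow> 'i \<Rightarrow> real" and \<iota> :: "'i \<Rightarrow> 'j"
  assumes inj: "inj_on \<iota> I"
    and sum: "\<And>x y. ((\<lambda>i. (\<psi> x i - \<psi> y i)\<^sup>2) has_sum D x y) I"
  obtains \<phi> :: "'x \<Rightarrow> 'j \<Rightarrow> real"
  where "\<And>x. \<phi> x \<in> carrier l2_module"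
    and "\<And>x y. mdist (ip_metric l2_module l2_inner) (\<phi> x) (\<phi> y) = sqrt (D x y)"
proof -
  fix p :: 'x
  define \<phi> where "\<phi> x j = (if j \<in> \<iota> ` I then \<psi> x (inv_into I \<iota> j) - \<psi> p (inv_into I \<iota> j) else 0)" for x j
  have transfer: "((\<lambda>j. (a j)\<^sup>2) has_sum s) UNIV"
    if "\<And>i. i \<in> I \<Longrightarrow> a (\<iota> i) = b i" "\<And>j. j \<notin> \<iota> ` I \<Longrightarrow> a j = 0" "((\<lambda>i. (b i)\<^sup>2) has_sum s) I"
    for a b :: "_ \<Rightarrow> real" and s
  proof -
    have "(((\<lambda>j. (a j)\<^sup>2) \<circ> \<iota>) has_sum s) I"
      using that(1,3) by (subst has_sum_cong[where g = "\<lambda>i. (b i)\<^sup>2"]) auto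
    then have "((\<lambda>j. (a j)\<^sup>2) has_sum s) (\<iota> ` I)"
      by (simp add: has_sum_reindex[OF inj])
    then show ?thesis
      by (rule has_sum_cong_neutral[THEN iffD1, rotated -1]) (auto simp: that(2))
  qed
  show thesis
  proof (rule that)
    show mem: "\<phi> x \<in> carrier l2_module" for x
    proof -
      have "((\<lambda>j. (\<phi> x j)\<^sup>2) has_sum D x p) UNIV"
        by (rule transfer[OF _ _ sum]) (auto simp: \<phi>_def inj)
      then show ?thesis
        by (auto intro: has_sum_imp_summable)
    qed
    fix x y
    have "((\<lambda>j. (\<phi> x j - \<phi> y j)\<^sup>2) has_sum D x y) UNIV"
      by (rule transfer[OF _ _ sum]) (auto simp: \<phi>_def inj)
    then show "mdist (ip_metric l2_module l2_inner) (\<phi> x) (\<phi> y) = sqrt (D x y)"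
      unfolding mdist_l2[OF mem mem] by (simp add: infsumI)
  qed
qed

section \<open>Features of Gaussian kernels\<close>

definition orthonormal :: "'h::real_inner set \<Rightarrow> bool" where
  "orthonormal B \<longleftrightarrow> (\<forall>a\<in>B. \<forall>b\<in>B. a \<bullet> b = (if a = b then 1 else 0))"

text \<open>Zorn: a maximal orthonormal set has trivial orthogonal complement, since otherwise a
  normalised vector from it could be adjoined.\<close>

lemma exists_maximal_orthonormal:
  obtains B :: "'h::real_inner set"
  where "orthonormal B" "\<And>x. (\<And>b. b \<in> B \<Longrightarrow> x \<bullet> b = 0) \<Longrightarrow> x = 0"
proof -
  have "\<exists>B\<in>Collect orthonormal. \<forall>C\<in>Collect orthonormal. B \<subseteq> C \<longrightarrow> C = (B :: 'h set)"
  proof (rule subset_Zorn')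
    fix \<C> :: "'h set set"
    assume chain: "subset.chain (Collect orthonormal) \<C>"
    have "a \<bullet> b = (if a = b then 1 else 0)" if "A \<in> \<C>" "a \<in> A" "C \<in> \<C>" "b \<in> C" for A C a b
    proof -
      have "orthonormal A" "orthonormal C" "A \<subseteq> C \<or> C \<subseteq> A"
        using chain that unfolding subset.chain_def by blast+
      then show ?thesis
        using that unfolding orthonormal_def by blast
    qed
    then show "\<Union>\<C> \<in> Collect orthonormal"
      unfolding orthonormal_def by blast
  qed
  then obtain B :: "'h set" where B: "orthonormal B"
    and max: "\<And>C. orthonormal C \<Longrightarrow> B \<subseteq> C \<Longrightarrow> C = B"
    by auto
  show thesis
  proof (rule that[OF B])
    fix x :: 'h
    assume orth: "\<And>b. b \<in> B \<Longrightarrow> x \<bullet> b = 0"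
    show "x = 0"
    proof (rule ccontr)
      assume "x \<noteq> 0"
      then have unit: "sgn x \<bullet> sgn x = 1"
        by (simp add: dot_square_norm norm_sgn)
      have orth': "sgn x \<bullet> b = 0" "b \<bullet> sgn x = 0" if "b \<in> B" for b
        using orth[OF that] by (simp_all add: sgn_div_norm inner_commute)
      have "orthonormal (insert (sgn x) B)"
        using B unit orth' unfolding orthonormal_def by (metis insert_iff zero_neq_one)
      then have "sgn x \<in> B"
        using max by blast
      then show False
        using orth' unit by force
    qed
  qed
qed

lemma inner_sum_orthonormal:
  assumes "orthonormal B" "finite F" "F \<subseteq> B"
  shows "(\<Sum>b\<in>F. c b *\<^sub>R b) \<bullet> (\<Sum>b\<in>F. d b *\<^sub>R b) = (\<Sum>b\<in>F. c b * d b)"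
proof -
  have "(\<Sum>b\<in>F. c b *\<^sub>R b) \<bullet> (\<Sum>b\<in>F. d b *\<^sub>R b) = (\<Sum>a\<in>F. \<Sum>b\<in>F. c a * d b * (a \<bullet> b))"
    by (simp only: inner_sum_left) (simp add: inner_sum_right sum_distrib_left mult_ac)
  also have "\<dots> = (\<Sum>a\<in>F. \<Sum>b\<in>F. if b = a then c a * d b else 0)"
    using assms unfolding orthonormal_def by (intro sum.cong refl) (auto simp: subset_iff)
  finally show ?thesis
    using assms(2) by simp
qed

text \<open>\<open>?p\<close> is the orthogonal projection of \<open>x\<close> onto the span of
  \<open>F\<close>, and \<open>x - ?p\<close> has a nonnegative inner product with itself.\<close>

lemma Bessel_inequality:
  assumes "orthonormal B" "finite F" "F \<subseteq> B"
  shows "(\<Sum>b\<in>F. (x \<bullet> b)\<^sup>2) \<le> x \<bullet> x"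
proof -
  let ?p = "\<Sum>b\<in>F. (x \<bullet> b) *\<^sub>R b"
  have pp: "?p \<bullet> ?p = (\<Sum>b\<in>F. (x \<bullet> b)\<^sup>2)"
    using inner_sum_orthonormal[OF assms, of "\<lambda>b. x \<bullet> b" "\<lambda>b. x \<bullet> b"] by (simp add: power2_eq_square)
  have xp: "x \<bullet> ?p = (\<Sum>b\<in>F. (x \<bullet> b)\<^sup>2)"
    by (simp add: inner_sum_right power2_eq_square)
  have "0 \<le> (x - ?p) \<bullet> (x - ?p)"
    by simp
  also have "\<dots> = x \<bullet> x - 2 * (x \<bullet> ?p) + ?p \<bullet> ?p"
    by (simp only: inner_diff_left inner_diff_right inner_commute[of ?p x])
  finally show ?thesis
    using pp xp by simp
qed

text \<open>By Pythagoras the squared distance between nested partial sums is a difference of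
  partial sums of squared coefficients. The net of finite partial sums is therefore Cauchy, and the
  space is complete.\<close>

lemma summable_on_orthonormal:
  fixes B :: "'h::{real_inner, complete_space} set"
  assumes B: "orthonormal B" and c: "(\<lambda>b. (c b)\<^sup>2) summable_on B"
  shows "(\<lambda>b. c b *\<^sub>R b) summable_on B"
proof -
  let ?f = "\<lambda>b. c b *\<^sub>R b" and ?g = "\<lambda>b. (c b)\<^sup>2"
  define S where "S = infsum ?g B"
  have S: "(sum ?g \<longlongrightarrow> S) (finite_subsets_at_top B)"
    unfolding S_def using c by (rule infsum_tendsto)
  have "\<exists>P. eventually P (finite_subsets_at_top B) \<and>
      (\<forall>F F'. P F \<and> P F' \<longrightarrow> dist (sum ?f F) (sum ?f F') < e)" if "e > 0" for e
  proof -
    \<comment> \<open>Partial sums of \<open>?g\<close> within \<open>d\<close> of \<open>S\<close>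
      differ by less than \<open>2 * d\<close>, the square of \<open>e / 2\<close>.\<close>
    define d where "d = (e / 2)\<^sup>2 / 2"
    have d: "d > 0"
      using that by (simp add: d_def)
    have "\<forall>\<^sub>F F in finite_subsets_at_top B. dist (sum ?g F) S < d"
      using S d by (rule tendstoD)
    then obtain G where G: "finite G" "G \<subseteq> B"
      and close: "\<And>F. finite F \<Longrightarrow> G \<subseteq> F \<Longrightarrow> F \<subseteq> B \<Longrightarrow> dist (sum ?g F) S < d"
      unfolding eventually_finite_subsets_at_top by metis
    have near: "dist (sum ?f F) (sum ?f G) < e / 2" if F: "finite F" "G \<subseteq> F" "F \<subseteq> B" for F
    proof -
      have "sum ?f F - sum ?f G = sum ?f (F - G)"
        using F by (simp add: sum_diff)
      then have "(dist (sum ?f F) (sum ?f G))\<^sup>2 = sum ?f (F - G) \<bullet> sum ?f (F - G)"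
        unfolding dist_norm power2_norm_eq_inner by (rule arg_cong)
      also have "\<dots> = sum ?g (F - G)"
        unfolding power2_eq_square using F by (intro inner_sum_orthonormal[OF B]) auto
      also have "\<dots> = sum ?g F - sum ?g G"
        using F by (simp add: sum_diff)
      also have "\<dots> < 2 * d"
        using close[OF F] close[OF G(1) order_refl G(2)] unfolding dist_real_def by linarith
      also have "\<dots> = (e / 2)\<^sup>2"
        by (simp add: d_def)
      finally show ?thesis
        by (rule power_less_imp_less_base) (use \<open>e > 0\<close> in simp)
    qed
    show ?thesis
    proof (intro exI conjI allI impI)
      show "\<forall>\<^sub>F F in finite_subsets_at_top B. finite F \<and> G \<subseteq> F \<and> F \<subseteq> B"
        unfolding eventually_finite_subsets_at_top using G by (intro exI[of _ G]) simp
      fix F F'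
      assume "(finite F \<and> G \<subseteq> F \<and> F \<subseteq> B) \<and> (finite F' \<and> G \<subseteq> F' \<and> F' \<subseteq> B)"
      then have "dist (sum ?f F) (sum ?f G) < e / 2" "dist (sum ?f F') (sum ?f G) < e / 2"
        using near[of F] near[of F'] by simp_all
      then show "dist (sum ?f F) (sum ?f F') < e"
        by (rule dist_triangle_half_l)
    qed
  qed
  then have "cauchy_filter (filtermap (sum ?f) (finite_subsets_at_top B))"
    unfolding cauchy_filter_metric_filtermap by (intro allI impI)
  then obtain L where "filtermap (sum ?f) (finite_subsets_at_top B) \<le> nhds L"
    unfolding convergent_filter_iff_cauchy[symmetric] convergent_filter_iff by (elim exE)
  then have "(?f has_sum L) B"
    unfolding has_sum_def filterlim_def .
  then show ?thesis
    by (rule has_sum_imp_summable)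
qed

text \<open>The series of \<open>(x \<bullet> b) *\<^sub>R b\<close> has a sum \<open>z\<close> with
  the same coefficients as \<open>x\<close>, so \<open>max\<close> gives \<open>x = z\<close>; then
  take the inner product with \<open>y\<close>.\<close>

lemma has_sum_inner_orthonormal:
  fixes B :: "'h::{real_inner, complete_space} set"
  assumes B: "orthonormal B" and max: "\<And>x. (\<And>b. b \<in> B \<Longrightarrow> x \<bullet> b = 0) \<Longrightarrow> x = 0"
  shows "((\<lambda>b. (x \<bullet> b) * (y \<bullet> b)) has_sum x \<bullet> y) B"
proof -
  have "(\<lambda>b. (x \<bullet> b)\<^sup>2) summable_on B"
    using Bessel_inequality[OF B] by (intro nonneg_bdd_above_summable_on bdd_aboveI2) auto
  from summable_on_orthonormal[OF B this]
  obtain z where z: "((\<lambda>b. (x \<bullet> b) *\<^sub>R b) has_sum z) B"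
    by (auto simp: summable_on_def)
  have zy: "((\<lambda>b. (x \<bullet> b) * (b \<bullet> y)) has_sum z \<bullet> y) B" for y
    using has_sum_bounded_linear[OF bounded_linear_inner_left z, of y] by simp
  have "x - z = 0"
  proof (rule max)
    fix b assume b: "b \<in> B"
    have "((\<lambda>a. (x \<bullet> a) * (a \<bullet> b)) has_sum x \<bullet> b) B"
      using B b by (intro has_sum_finite_neutralI[of "{b}"]) (auto simp: orthonormal_def)
    then show "(x - z) \<bullet> b = 0"
      using has_sum_unique[OF zy[of b]] by (simp add: inner_diff_left)
  qed
  then show ?thesis
    using zy[of y] by (simp add: inner_commute)
qed

lemma exists_orthonormal_basis:
  obtains B :: "'h::{real_inner, complete_space} set"
  where "\<And>x y. ((\<lambda>b. (x \<bullet> b) * (y \<bullet> b)) has_sum x \<bullet> y) B"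
proof (rule exists_maximal_orthonormal)
  fix B :: "'h set"
  assume "orthonormal B" and "\<And>x. (\<And>b. b \<in> B \<Longrightarrow> x \<bullet> b = 0) \<Longrightarrow> x = 0"
  then show thesis
    by (rule that[OF has_sum_inner_orthonormal])
qed

section \<open>Tensor powers and the expansion of the Gaussian kernel\<close>

text \<open>Iterating the sums requires summability over the pairs. For \<open>p = q\<close> the
  terms are squares and the iterated sum provides it; mixed products follow by Cauchy-Schwarz. Hence
  the hypotheses range over all \<open>p\<close> and \<open>q\<close>.\<close>

lemma has_sum_Sigma_products:
  fixes f :: "'p \<Rightarrow> 'a \<times> 'b \<Rightarrow> real"
  assumes inner: "\<And>p q x. x \<in> A \<Longrightarrow> ((\<lambda>y. f p (x, y) * f q (x, y)) has_sum g p q x) (B x)"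
    and outer: "\<And>p q. (g p q has_sum s p q) A"
  shows "((\<lambda>z. f p z * f q z) has_sum s p q) (Sigma A B)"
proof (rule has_sum_SigmaI[OF _ outer])
  have "(\<lambda>z. f p z * f p z) summable_on Sigma A B" for p
    using inner has_sum_imp_summable[OF outer] by (intro summable_on_SigmaI[where g = "g p p"]) auto
  from this[THEN summable_on_iff_abs_summable_on_real[THEN iffD1]]
  show "(\<lambda>z. f p z * f q z) summable_on Sigma A B"
    by (intro abs_summable_summable[OF abs_summable_product])
qed (rule inner)

text \<open>The products over lists are the coordinates of the \<open>n\<close>-fold tensor power of
  \<open>x\<close>, whose inner product with that of \<open>y\<close> is
  \<open>(x \<bullet> y) ^ n\<close>. The induction splits off the head of the list.\<close>

lemma has_sum_inner_power:
  fixes B :: "'h::{real_inner, complete_space} set"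
  assumes parseval: "\<And>x y :: 'h. ((\<lambda>b. (x \<bullet> b) * (y \<bullet> b)) has_sum x \<bullet> y) B"
  shows "((\<lambda>l. (\<Prod>b\<leftarrow>l. x \<bullet> b) * (\<Prod>b\<leftarrow>l. y \<bullet> b)) has_sum (x \<bullet> y) ^ n) {l. set l \<subseteq> B \<and> length l = n}"
proof (induction n arbitrary: x y)
  case 0
  have *: "{l. set l \<subseteq> B \<and> length l = 0} = {[]}"
    by auto
  show ?case
    unfolding * by (rule has_sum_finiteI) simp_all
next
  case (Suc n)
  let ?L = "\<lambda>n. {l. set l \<subseteq> B \<and> length l = n}"
  define f where "f x = (\<lambda>(b, l). (x \<bullet> b) * (\<Prod>a\<leftarrow>l. x \<bullet> a))" for x :: 'h
  have "((\<lambda>z. f x z * f y z) has_sum (x \<bullet> y) * (x \<bullet> y) ^ n) (B \<times> ?L n)"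
  proof (rule has_sum_Sigma_products[where f = f and p = x and q = y
        and g = "\<lambda>x y b. (x \<bullet> b) * (y \<bullet> b) * (x \<bullet> y) ^ n" and s = "\<lambda>x y. (x \<bullet> y) * (x \<bullet> y) ^ n"])
    show "((\<lambda>l. f x (b, l) * f y (b, l)) has_sum (x \<bullet> b) * (y \<bullet> b) * (x \<bullet> y) ^ n) (?L n)" for x y b
      using has_sum_cmult_right[OF Suc.IH[of x y], of "(x \<bullet> b) * (y \<bullet> b)"]
      unfolding f_def prod.case by (simp only: mult_ac)
    show "((\<lambda>b. (x \<bullet> b) * (y \<bullet> b) * (x \<bullet> y) ^ n) has_sum (x \<bullet> y) * (x \<bullet> y) ^ n) B" for x y
      by (rule has_sum_cmult_left[OF parseval])
  qed
  moreover have "bij_betw (\<lambda>(b, l). b # l) (B \<times> ?L n) (?L (Suc n))"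
    unfolding bij_betw_def
  proof
    show "inj_on (\<lambda>(b, l). b # l) (B \<times> ?L n)"
      by (auto simp: inj_on_def)
    show "(\<lambda>(b, l). b # l) ` (B \<times> ?L n) = ?L (Suc n)"
    proof (rule Set.set_eqI)
      show "l \<in> (\<lambda>(b, l). b # l) ` (B \<times> ?L n) \<longleftrightarrow> l \<in> ?L (Suc n)" for l
        by (cases l) auto
    qed
  qed
  then have "((\<lambda>z. (\<lambda>l. (\<Prod>b\<leftarrow>l. x \<bullet> b) * (\<Prod>b\<leftarrow>l. y \<bullet> b)) (case z of (b, l) \<Rightarrow> b # l)) has_sum s) (B \<times> ?L n) \<longleftrightarrow>
      ((\<lambda>l. (\<Prod>b\<leftarrow>l. x \<bullet> b) * (\<Prod>b\<leftarrow>l. y \<bullet> b)) has_sum s) (?L (Suc n))" for s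
    by (rule has_sum_reindex_bij_betw)
  ultimately show ?case
    unfolding f_def case_prod_unfold power_Suc list.map prod_list.Cons by simp
qed

text \<open>Expanding the exponential series in
  \<open>exp (-t |u - v|\<^sup>2) = exp (-t |u|\<^sup>2) exp (-t |v|\<^sup>2) exp (2 t \<langle>u, v\<rangle>)\<close> gives one coordinate for every
  \<open>n\<close> and every list of \<open>n\<close> elements of an orthonormal basis.\<close>

definition gauss_feature :: "real \<Rightarrow> 'h::real_inner \<Rightarrow> nat \<times> 'h list \<Rightarrow> real" where
  "gauss_feature t u = (\<lambda>(n, l). exp (- t * (u \<bullet> u)) * sqrt ((2 * t) ^ n / fact n) * (\<Prod>b\<leftarrow>l. u \<bullet> b))"

lemma has_sum_gauss_feature:
  fixes B :: "'h::{real_inner, complete_space} set"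
  assumes parseval: "\<And>x y :: 'h. ((\<lambda>b. (x \<bullet> b) * (y \<bullet> b)) has_sum x \<bullet> y) B"
    and t: "t \<ge> 0"
  shows "((\<lambda>i. gauss_feature t u i * gauss_feature t v i) has_sum exp (- t * (dist u v)\<^sup>2))
    (SIGMA n:UNIV. {l. set l \<subseteq> B \<and> length l = n})"
proof (rule has_sum_Sigma_products)
  let ?e = "\<lambda>u v. exp (- t * (u \<bullet> u)) * exp (- t * (v \<bullet> v))"
  \<comment> \<open>Summing over the lists of length \<open>n\<close> leaves the \<open>n\<close>-th
    term of the series of \<open>exp (2 * t * (u \<bullet> v))\<close>, times
    \<open>?e u v\<close>.\<close>
  let ?g = "\<lambda>u v n. ?e u v * ((2 * t * (u \<bullet> v)) ^ n / fact n)"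
  show "((\<lambda>l. gauss_feature t u (n, l) * gauss_feature t v (n, l)) has_sum ?g u v n)
      {l. set l \<subseteq> B \<and> length l = n}" for u v n
  proof -
    have "sqrt ((2 * t) ^ n / fact n) * sqrt ((2 * t) ^ n / fact n) = (2 * t) ^ n / fact n"
      using t by (intro real_sqrt_mult_self[THEN trans]) simp
    then have "gauss_feature t u (n, l) * gauss_feature t v (n, l)
        = ?e u v * ((2 * t) ^ n / fact n) * ((\<Prod>b\<leftarrow>l. u \<bullet> b) * (\<Prod>b\<leftarrow>l. v \<bullet> b))" for l
      unfolding gauss_feature_def by (simp only: prod.case mult_ac)
    then show ?thesis
      using has_sum_cmult_right[OF has_sum_inner_power[OF parseval, of u v n], of "?e u v * ((2 * t) ^ n / fact n)"]
      by (simp add: power_mult_distrib mult_ac)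
  qed
  show "(?g u v has_sum exp (- t * (dist u v)\<^sup>2)) UNIV" for u v
  proof -
    have "(dist u v)\<^sup>2 = u \<bullet> u - 2 * (u \<bullet> v) + v \<bullet> v"
      by (simp add: dist_norm power2_norm_eq_inner inner_diff_left inner_diff_right inner_commute)
    then have eq: "exp (- t * (dist u v)\<^sup>2) = ?e u v * exp (2 * t * (u \<bullet> v))"
      unfolding exp_add[symmetric] by (simp add: right_diff_distrib distrib_left)
    have "summable (\<lambda>n. norm ((2 * t * (u \<bullet> v)) ^ n /\<^sub>R fact n))"
      by (rule summable_norm_exp)
    then have "((\<lambda>n. (2 * t * (u \<bullet> v)) ^ n /\<^sub>R fact n) has_sum exp (2 * t * (u \<bullet> v))) UNIV"
      using exp_converges by (rule norm_summable_imp_has_sum)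
    from has_sum_cmult_right[OF this, of "?e u v"] show ?thesis
      unfolding eq by (simp add: divide_inverse mult_ac)
  qed
qed

section \<open>Encoding the coordinates by points of an infinite type\<close>

lemma infinite_UNIV_real_vector:
  fixes v :: "'v::real_vector"
  assumes "v \<noteq> 0"
  shows "infinite (UNIV :: 'v set)"
proof -
  have "inj (\<lambda>r :: real. r *\<^sub>R v)"
    using assms by (auto simp: inj_on_def)
  then show ?thesis
    using infinite_UNIV_char_0 [where 'a = real] finite_imageD finite_subset subset_UNIV by metis
qed

text \<open>The theorem fixes the type of the target space, so this many coordinates must fit into
  the given type. An infinite type is equipotent with its square; folding a pairing function encodes
  lists, but injectively only at a fixed length, so the length is recorded in the tag
  \<open>prod_encode (m, n)\<close>.\<close>

lemma exists_list_encoding: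
  assumes "infinite (UNIV :: 'a set)"
  obtains \<iota> :: "nat \<times> nat \<times> 'a list \<Rightarrow> 'a" where "inj_on \<iota> {(m, n, l). length l = n}"
proof -
  obtain p :: "'a \<times> 'a \<Rightarrow> 'a" where "bij_betw p (UNIV \<times> UNIV) UNIV"
    using card_of_Times_same_infinite[OF assms] card_of_ordIso by blast
  then have p: "p z = p w \<longleftrightarrow> z = w" for z w
    using inj_on_eq_iff[of p UNIV z w] by (simp add: bij_betw_def)
  obtain e :: "nat \<Rightarrow> 'a" where "inj e"
    using infinite_countable_subset[OF assms] by blast
  then have e: "e m = e n \<longleftrightarrow> m = n" for m n
    by (simp add: inj_eq)
  define c where "c l = foldr (\<lambda>b a. p (b, a)) l (e 0)" for l
  have c: "l = l'" if "length l = length l'" "c l = c l'" for l l'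
    using that by (induction l l' rule: list_induct2) (simp_all add: c_def p)
  have "inj_on (\<lambda>(m, n, l). p (e (prod_encode (m, n)), c l)) {(m, n, l). length l = n}"
    using c by (auto simp: inj_on_def p e)
  then show thesis
    by (rule that)
qed

section \<open>Gaussian discrepancies of tuples\<close>

lemma has_sum_sum:
  fixes f :: "'a \<Rightarrow> 'i \<Rightarrow> real"
  assumes "\<And>a. a \<in> A \<Longrightarrow> (f a has_sum s a) I"
  shows "((\<lambda>i. \<Sum>a\<in>A. f a i) has_sum (\<Sum>a\<in>A. s a)) I"
  using assms
proof (induction A rule: infinite_finite_induct)
  case (insert a A)
  then show ?case
    by (simp add: has_sum_add)
qed simp_all

lemma has_sum_diff:
  fixes f g :: "'i \<Rightarrow> real"
  assumes "(f has_sum a) I" "(g has_sum b) I"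
  shows "((\<lambda>i. f i - g i) has_sum a - b) I"
  using has_sum_add[OF assms(1) has_sum_uminusI[OF assms(2)]] by simp

text \<open>The squared distance in the feature space of \<open>exp (-t d\<^sup>2)\<close> between the sums of the features of
  the two tuples (a maximum mean discrepancy).\<close>

definition gauss_mmd :: "real \<Rightarrow> nat \<Rightarrow> (nat \<Rightarrow> 'a::metric_space) \<Rightarrow> (nat \<Rightarrow> 'a) \<Rightarrow> real" where
  "gauss_mmd t k x y = (\<Sum>i<k. \<Sum>j<k. exp (- t * (dist (x i) (x j))\<^sup>2)
     + exp (- t * (dist (y i) (y j))\<^sup>2) - 2 * exp (- t * (dist (x i) (y j))\<^sup>2))"

lemma sum_diff_squared:
  fixes a b :: "'i \<Rightarrow> real"
  shows "((\<Sum>i\<in>A. a i) - (\<Sum>i\<in>A. b i))\<^sup>2 = (\<Sum>i\<in>A. \<Sum>j\<in>A. a i * a j + b i * b j - 2 * (a i * b j))"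
  unfolding power2_diff unfolding power2_eq_square mult.assoc sum_product
  by (simp add: sum.distrib sum_subtractf sum_distrib_left mult_ac)

text \<open>Expanding the square leaves only products of features, that is, kernel values.
  Nonnegativity of \<open>gauss_mmd\<close> comes from here as well.\<close>

lemma has_sum_gauss_mmd:
  fixes \<Phi> :: "'a::metric_space \<Rightarrow> 'i \<Rightarrow> real"
  assumes \<Phi>: "\<And>u v. ((\<lambda>i. \<Phi> u i * \<Phi> v i) has_sum exp (- t * (dist u v)\<^sup>2)) I"
  shows "((\<lambda>i. ((\<Sum>j<k. \<Phi> (x j) i) - (\<Sum>j<k. \<Phi> (y j) i))\<^sup>2) has_sum gauss_mmd t k x y) I"
  unfolding sum_diff_squared gauss_mmd_def
  by (intro has_sum_sum has_sum_add has_sum_diff has_sum_cmult_right \<Phi>)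

section \<open>Upper bound along an optimal matching\<close>

lemma sum_squares_le_square_sum:
  fixes a :: "'i \<Rightarrow> real"
  assumes "\<And>i. i \<in> A \<Longrightarrow> 0 \<le> a i"
  shows "(\<Sum>i\<in>A. (a i)\<^sup>2) \<le> (\<Sum>i\<in>A. a i)\<^sup>2"
  using assms
proof (induction A rule: infinite_finite_induct)
  case (insert i A)
  then have "(\<Sum>i\<in>A. (a i)\<^sup>2) \<le> (\<Sum>i\<in>A. a i)\<^sup>2" "0 \<le> a i * (\<Sum>i\<in>A. a i)"
    by (auto intro!: mult_nonneg_nonneg sum_nonneg)
  then show ?case
    using insert.hyps by (simp add: power2_sum)
qed simp_all

text \<open>Reorder \<open>y\<close> along an optimal matching. Cauchy-Schwarz costs a factor
  \<open>k\<close>, a pair at distance \<open>d\<close> contributes at most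
  \<open>2 * t * d^2\<close> by \<open>exp a \<ge> 1 + a\<close>, and the squares of the matched
  distances add up to at most the square of \<open>k * matching_cost k x y\<close>.\<close>

lemma gauss_mmd_le:
  fixes \<Phi> :: "'a::metric_space \<Rightarrow> 'i \<Rightarrow> real" and x y :: "nat \<Rightarrow> 'a"
  assumes \<Phi>: "\<And>u v. ((\<lambda>i. \<Phi> u i * \<Phi> v i) has_sum exp (- t * (dist u v)\<^sup>2)) I"
    and k: "k > 0" and t: "t \<ge> 0"
  shows "gauss_mmd t k x y \<le> 2 * t * real k ^ 3 * (matching_cost k x y)\<^sup>2"
proof -
  obtain p where p: "p permutes {..<k}"
    and "matching_cost k x y = (\<Sum>i<k. dist (x i) (y (p i))) / real k"
    by (rule matching_cost_attained)
  then have cost: "(\<Sum>i<k. dist (x i) (y (p i))) = real k * matching_cost k x y"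
    using k by simp
  have pair: "((\<lambda>i. (\<Phi> u i - \<Phi> v i)\<^sup>2) has_sum 2 - 2 * exp (- t * (dist u v)\<^sup>2)) I" for u v
    using has_sum_gauss_mmd[OF \<Phi>, where k = 1 and x = "\<lambda>_. u" and y = "\<lambda>_. v"] by (simp add: gauss_mmd_def)
  have "gauss_mmd t k x y \<le> (\<Sum>j<k. 2 - 2 * exp (- t * (dist (x j) (y (p j)))\<^sup>2)) * real k"
  proof (rule has_sum_mono)
    show "((\<lambda>i. ((\<Sum>j<k. \<Phi> (x j) i) - (\<Sum>j<k. \<Phi> (y j) i))\<^sup>2) has_sum gauss_mmd t k x y) I"
      by (rule has_sum_gauss_mmd[OF \<Phi>])
    show "((\<lambda>i. (\<Sum>j<k. (\<Phi> (x j) i - \<Phi> (y (p j)) i)\<^sup>2) * real k) has_sum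
        (\<Sum>j<k. 2 - 2 * exp (- t * (dist (x j) (y (p j)))\<^sup>2)) * real k) I"
      by (intro has_sum_cmult_left has_sum_sum pair)
    fix i
    have "(\<Sum>j<k. \<Phi> (x j) i) - (\<Sum>j<k. \<Phi> (y j) i) = (\<Sum>j<k. \<Phi> (x j) i - \<Phi> (y (p j)) i)"
      using sum.permute[OF p, of "\<lambda>j. \<Phi> (y j) i"] by (simp add: sum_subtractf o_def)
    then show "((\<Sum>j<k. \<Phi> (x j) i) - (\<Sum>j<k. \<Phi> (y j) i))\<^sup>2
        \<le> (\<Sum>j<k. (\<Phi> (x j) i - \<Phi> (y (p j)) i)\<^sup>2) * real k"
      using sum_squared_le_sum_of_squares[of "\<lambda>j. \<Phi> (x j) i - \<Phi> (y (p j)) i" "{..<k}"] by simp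
  qed
  also have "\<dots> \<le> (\<Sum>j<k. 2 * t * (dist (x j) (y (p j)))\<^sup>2) * real k"
  proof (intro mult_right_mono sum_mono)
    show "2 - 2 * exp (- t * (dist (x j) (y (p j)))\<^sup>2) \<le> 2 * t * (dist (x j) (y (p j)))\<^sup>2" for j
      using exp_ge_add_one_self[of "- t * (dist (x j) (y (p j)))\<^sup>2"] by simp
  qed simp
  also have "\<dots> = 2 * t * real k * (\<Sum>j<k. (dist (x j) (y (p j)))\<^sup>2)"
    by (simp add: mult_ac flip: sum_distrib_left)
  also have "\<dots> \<le> 2 * t * real k * (real k * matching_cost k x y)\<^sup>2"
    using t unfolding cost[symmetric] by (intro mult_left_mono sum_squares_le_square_sum) auto
  also have "\<dots> = 2 * t * real k ^ 3 * (matching_cost k x y)\<^sup>2"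
    by (simp add: power2_eq_square power3_eq_cube)
  finally show ?thesis .
qed

section \<open>Lower bound at scales with a gap\<close>

text \<open>The discrepancy of the ideal 0/1 kernel equals the sum over the classes \<open>C\<close>
  of \<open>(a C - b C)^2\<close>, where \<open>a\<close> and \<open>b\<close> count members;
  different multisets make one of these integer differences nonzero.\<close>

lemma class_discrepancy_ge_1:
  fixes f g :: "'i \<Rightarrow> 'c"
  assumes fin: "finite A" and ne: "image_mset f (mset_set A) \<noteq> image_mset g (mset_set A)"
  shows "1 \<le> (\<Sum>i\<in>A. \<Sum>j\<in>A. of_bool (f i = f j) + of_bool (g i = g j) - 2 * of_bool (f i = g j) :: real)"
proof -
  let ?C = "f ` A \<union> g ` A"
  define a b where "a C = real (card {i \<in> A. f i = C})" and "b C = real (card {i \<in> A. g i = C})" for C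
  have a: "a C = (\<Sum>i\<in>A. of_bool (f i = C))" and b: "b C = (\<Sum>i\<in>A. of_bool (g i = C))" for C
    using fin by (simp_all add: a_def b_def Int_def)
  have "(\<Sum>C\<in>?C. (a C - b C)\<^sup>2) = (\<Sum>C\<in>?C. \<Sum>i\<in>A. \<Sum>j\<in>A. of_bool (f i = C) * of_bool (f j = C)
      + of_bool (g i = C) * of_bool (g j = C) - 2 * (of_bool (f i = C) * of_bool (g j = C)))"
    unfolding a b sum_diff_squared ..
  also have "\<dots> = (\<Sum>i\<in>A. \<Sum>j\<in>A. \<Sum>C\<in>?C. of_bool (f i = C) * of_bool (f j = C)
      + of_bool (g i = C) * of_bool (g j = C) - 2 * (of_bool (f i = C) * of_bool (g j = C)))"
    by (subst sum.swap, rule sum.cong[OF refl], rule sum.swap)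
  also have "\<dots> = (\<Sum>i\<in>A. \<Sum>j\<in>A. of_bool (f i = f j) + of_bool (g i = g j) - 2 * of_bool (f i = g j))"
  proof (intro sum.cong refl)
    fix i j assume "i \<in> A" "j \<in> A"
    have pick: "(\<Sum>C\<in>?C. of_bool (c = C) * of_bool (d = C)) = (of_bool (c = d) :: real)" if "c \<in> ?C" for c d
    proof -
      have "(\<Sum>C\<in>?C. of_bool (c = C) * of_bool (d = C)) = (\<Sum>C\<in>?C. if C = c then of_bool (c = d) else 0 :: real)"
        by (intro sum.cong) auto
      then show ?thesis
        using that fin by (simp only: sum.delta finite_UnI finite_imageI if_True)
    qed
    show "(\<Sum>C\<in>?C. of_bool (f i = C) * of_bool (f j = C) + of_bool (g i = C) * of_bool (g j = C)
        - 2 * (of_bool (f i = C) * of_bool (g j = C)))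
        = (of_bool (f i = f j) + of_bool (g i = g j) - 2 * of_bool (f i = g j) :: real)"
      unfolding sum.distrib sum_subtractf sum_distrib_left[symmetric]
      using \<open>i \<in> A\<close> by (simp only: pick UnI1 UnI2 imageI)
  qed
  finally have eq: "(\<Sum>C\<in>?C. (a C - b C)\<^sup>2)
      = (\<Sum>i\<in>A. \<Sum>j\<in>A. of_bool (f i = f j) + of_bool (g i = g j) - 2 * of_bool (f i = g j))" .
  obtain C where "count (image_mset f (mset_set A)) C \<noteq> count (image_mset g (mset_set A)) C"
    using ne by (auto simp: multiset_eq_iff)
  then have C: "card {i \<in> A. f i = C} \<noteq> card {i \<in> A. g i = C}"
    using fin by (simp add: count_image_mset vimage_def Int_def conj_commute)
  then have "C \<in> ?C"
    by (cases "{i \<in> A. f i = C} = {} \<and> {i \<in> A. g i = C} = {}") auto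
  have "a C - b C \<in> \<int>" "a C - b C \<noteq> 0"
    using C by (simp_all add: a_def b_def)
  then have "1 \<le> (a C - b C)\<^sup>2"
    using Ints_nonzero_abs_ge1 by (metis abs_1 abs_square_le_1 linorder_le_cases power2_abs power_one
        abs_le_square_iff)
  also have "\<dots> \<le> (\<Sum>C\<in>?C. (a C - b C)\<^sup>2)"
    using fin \<open>C \<in> ?C\<close> by (intro member_le_sum) auto
  finally show ?thesis
    unfolding eq .
qed

text \<open>By the gap, being within distance \<open>s\<close> is an equivalence relation on the points, and at this \<open>t\<close> the
  kernel is within \<open>1/L\<close> of its indicator. If every class contained as many \<open>x i\<close> as \<open>y i\<close>, matching
  inside the classes would cost at most \<open>s\<close>.\<close>

lemma gauss_mmd_ge_half:
  fixes x y :: "nat \<Rightarrow> 'a::metric_space" and k :: nat and s :: real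
  defines "L \<equiv> 8 * (real k)\<^sup>2" and "Z \<equiv> x ` {..<k} \<union> y ` {..<k}"
  assumes k: "k > 0" and s: "s > 0" and cost: "matching_cost k x y > s"
    and gap: "\<And>u v. u \<in> Z \<Longrightarrow> v \<in> Z \<Longrightarrow> dist u v \<le> s \<or> L * s \<le> dist u v"
  shows "1 / 2 \<le> gauss_mmd (1 / (L * s\<^sup>2)) k x y"
proof -
  define t where "t = 1 / (L * s\<^sup>2)"
  have "(real k)\<^sup>2 \<ge> 1"
    using k by simp
  then have L: "L \<ge> 8"
    by (simp add: L_def)
  \<comment> \<open>A distance of at most \<open>s + s\<close> is thus below the upper end of the
    gap, which makes closeness transitive.\<close>
  have "L * s > s + s"
    using L s mult_strict_right_mono[of 2 L s] by simp
  define cls where "cls u = {v \<in> Z. dist u v \<le> s}" for u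
  have cls: "cls u = cls v \<longleftrightarrow> dist u v \<le> s" if u: "u \<in> Z" and v: "v \<in> Z" for u v
  proof
    show "dist u v \<le> s" if "cls u = cls v"
    proof -
      have "v \<in> cls v"
        using v s by (simp add: cls_def)
      then have "v \<in> cls u"
        unfolding that .
      then show ?thesis
        by (simp add: cls_def)
    qed
    have "cls u \<subseteq> cls v" if "u \<in> Z" "v \<in> Z" "dist u v \<le> s" for u v
    proof
      fix w assume "w \<in> cls u"
      then have w: "w \<in> Z" "dist u w \<le> s"
        by (auto simp: cls_def)
      have "dist v w \<le> s + s"
        using dist_triangle[of v w u] w(2) that(3) by (simp add: dist_commute)
      then have "dist v w \<le> s"
        using gap[OF that(2) w(1)] \<open>L * s > s + s\<close> by auto
      with w show "w \<in> cls v"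
        by (simp add: cls_def)
    qed
    then show "cls u = cls v" if "dist u v \<le> s"
      using that u v by (metis dist_commute subset_antisym)
  qed
  have xZ: "x i \<in> Z" and yZ: "y i \<in> Z" if "i < k" for i
    using that by (auto simp: Z_def)
  have unbalanced: "image_mset (\<lambda>i. cls (x i)) (mset_set {..<k}) \<noteq> image_mset (\<lambda>i. cls (y i)) (mset_set {..<k})"
  proof
    assume "image_mset (\<lambda>i. cls (x i)) (mset_set {..<k}) = image_mset (\<lambda>i. cls (y i)) (mset_set {..<k})"
    from image_mset_eq_implies_permutes[OF finite_lessThan this]
    obtain p where p: "p permutes {..<k}" "\<forall>i\<in>{..<k}. cls (x i) = cls (y (p i))" .
    have "dist (x i) (y (p i)) \<le> s" if "i < k" for i
    proof -
      have "p i < k"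
        using permutes_in_image[OF p(1), of i] that by simp
      then show ?thesis
        using p(2) that cls[OF xZ[OF that] yZ[OF \<open>p i < k\<close>]] by simp
    qed
    then have "(\<Sum>i<k. dist (x i) (y (p i))) \<le> real k * s"
      using sum_bounded_above[of "{..<k}" "\<lambda>i. dist (x i) (y (p i))" s] by simp
    then have "(\<Sum>i<k. dist (x i) (y (p i))) / real k \<le> s"
      using k by (simp add: field_simps)
    then have "matching_cost k x y \<le> s"
      using matching_cost_le[OF p(1), of x y] by linarith
    with cost show False
      by simp
  qed
  let ?e = "\<lambda>u v. exp (- t * (dist u v)\<^sup>2)"
  \<comment> \<open>The choice of \<open>t\<close> balances both errors: on close pairs the exponent
    is at least \<open>- 1 / L\<close>, on far pairs at most \<open>- L\<close>, and
    \<open>exp (- L) \<le> 1 / L\<close>.\<close>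
  have close: "\<bar>?e u v - of_bool (cls u = cls v)\<bar> \<le> 1 / L" if "u \<in> Z" "v \<in> Z" for u v
  proof (cases "dist u v \<le> s")
    case True
    then have "(dist u v)\<^sup>2 \<le> s\<^sup>2"
      by (intro power_mono) auto
    then have "t * (dist u v)\<^sup>2 \<le> t * s\<^sup>2"
      using L by (intro mult_left_mono) (auto simp: t_def)
    also have "\<dots> = 1 / L"
      using s by (simp add: t_def)
    finally have "1 - 1 / L \<le> ?e u v"
      using exp_ge_add_one_self[of "- t * (dist u v)\<^sup>2"] by simp
    moreover have "?e u v \<le> 1"
      using L by (simp add: t_def)
    ultimately show ?thesis
      using True that by (simp add: cls)
  next
    case False
    then have "(L * s)\<^sup>2 \<le> (dist u v)\<^sup>2"
      using gap[OF that] L s by (intro power_mono) auto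
    then have "t * (L * s)\<^sup>2 \<le> t * (dist u v)\<^sup>2"
      using L by (intro mult_left_mono) (auto simp: t_def)
    moreover have "t * (L * s)\<^sup>2 = L"
      using s L by (simp add: t_def power_mult_distrib power2_eq_square)
    ultimately have "L \<le> exp (t * (dist u v)\<^sup>2)"
      using exp_ge_add_one_self[of "t * (dist u v)\<^sup>2"] by linarith
    then have "inverse (exp (t * (dist u v)\<^sup>2)) \<le> inverse L"
      using L by (intro le_imp_inverse_le) auto
    then have "?e u v \<le> 1 / L"
      by (simp add: exp_minus inverse_eq_divide)
    then show ?thesis
      using False that by (simp add: cls)
  qed
  have "1 \<le> (\<Sum>i<k. \<Sum>j<k. of_bool (cls (x i) = cls (x j)) + of_bool (cls (y i) = cls (y j))
      - 2 * of_bool (cls (x i) = cls (y j)) :: real)"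
    by (rule class_discrepancy_ge_1[OF finite_lessThan unbalanced])
  \<comment> \<open>Errors of \<open>1 / L\<close> with weights 1, 1 and 2 give \<open>4 / L\<close>
    per pair of indices; over all \<open>k * k\<close> pairs this is 1/2 by the choice of
    \<open>L\<close>.\<close>
  also have "\<dots> \<le> (\<Sum>i<k. \<Sum>j<k. (?e (x i) (x j) + ?e (y i) (y j) - 2 * ?e (x i) (y j)) + 4 / L)"
  proof (intro sum_mono)
    fix i j assume "i \<in> {..<k}" "j \<in> {..<k}"
    then have "\<bar>?e (x i) (x j) - of_bool (cls (x i) = cls (x j))\<bar> \<le> 1 / L"
      "\<bar>?e (y i) (y j) - of_bool (cls (y i) = cls (y j))\<bar> \<le> 1 / L"
      "\<bar>?e (x i) (y j) - of_bool (cls (x i) = cls (y j))\<bar> \<le> 1 / L"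
      by (intro close xZ yZ; simp)+
    then show "of_bool (cls (x i) = cls (x j)) + of_bool (cls (y i) = cls (y j))
        - 2 * of_bool (cls (x i) = cls (y j))
        \<le> (?e (x i) (x j) + ?e (y i) (y j) - 2 * ?e (x i) (y j)) + 4 / L"
      by linarith
  qed
  also have "\<dots> = gauss_mmd t k x y + (real k)\<^sup>2 * (4 / L)"
    unfolding gauss_mmd_def sum.distrib[of _ "\<lambda>_. 4 / L"] by (simp add: sum.distrib power2_eq_square)
  also have "(real k)\<^sup>2 * (4 / L) = 1 / 2"
    using k by (simp add: L_def)
  finally show ?thesis
    by (simp add: t_def)
qed

text \<open>The open intervals from \<open>L ^ m\<close> to \<open>L ^ (m + 1)\<close> are disjoint,
  so each pair of points spoils at most one scale \<open>m\<close>.\<close>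

lemma card_distance_scales_le:
  fixes L :: real
  assumes Z: "finite Z" and L: "L > 1"
  shows "finite {m :: nat. \<exists>u\<in>Z. \<exists>v\<in>Z. L ^ m < dist u v \<and> dist u v < L * L ^ m}"
    and "card {m :: nat. \<exists>u\<in>Z. \<exists>v\<in>Z. L ^ m < dist u v \<and> dist u v < L * L ^ m} \<le> (card Z)\<^sup>2"
proof -
  let ?S = "\<lambda>r. {m :: nat. L ^ m < r \<and> r < L * L ^ m}"
  have unique: "m = n" if "m \<in> ?S r" "n \<in> ?S r" for m n r
  proof (rule ccontr)
    have *: False if "m < n" "L ^ n < r" "r < L ^ Suc m" for m n
      using power_increasing[of "Suc m" n L] that L by simp
    assume "m \<noteq> n"
    then show False
      using that *[of m n] *[of n m] by (cases m n rule: linorder_cases) auto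
  qed
  have S: "finite (?S r) \<and> card (?S r) \<le> 1" for r
  proof (cases "?S r = {}")
    case True
    then show ?thesis
      by (simp only: finite.emptyI card.empty zero_le simp_thms)
  next
    case False
    then obtain m where "m \<in> ?S r"
      by blast
    then have "?S r = {m}"
      using unique by blast
    then show ?thesis
      by simp
  qed
  have eq: "{m :: nat. \<exists>u\<in>Z. \<exists>v\<in>Z. L ^ m < dist u v \<and> dist u v < L * L ^ m}
      = (\<Union>(u, v)\<in>Z \<times> Z. ?S (dist u v))"
    by auto
  show "finite {m :: nat. \<exists>u\<in>Z. \<exists>v\<in>Z. L ^ m < dist u v \<and> dist u v < L * L ^ m}"
    unfolding eq using Z S by auto
  have "card (\<Union>(u, v)\<in>Z \<times> Z. ?S (dist u v)) \<le> (\<Sum>(u, v)\<in>Z \<times> Z. card (?S (dist u v)))"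
    unfolding case_prod_unfold using Z by (intro card_UN_le) simp
  also have "\<dots> \<le> (\<Sum>_\<in>Z \<times> Z. 1)"
    using S by (intro sum_mono) auto
  also have "\<dots> = (card Z)\<^sup>2"
    by (simp add: card_cartesian_product power2_eq_square)
  finally show "card {m :: nat. \<exists>u\<in>Z. \<exists>v\<in>Z. L ^ m < dist u v \<and> dist u v < L * L ^ m} \<le> (card Z)\<^sup>2"
    unfolding eq .
qed

section \<open>The coarse embedding\<close>

text \<open>\<open>Z\<close> has at most \<open>2 * k\<close> points, so at most
  \<open>4 * k^2\<close> of the first \<open>M\<close> scales are spoilt. Each of the others has a
  gap and lies below the cost, so it contributes at least 1/2.\<close>

lemma gauss_mmd_scale_sum_ge:
  fixes x y :: "nat \<Rightarrow> 'a::metric_space" and k M :: nat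
  defines "L \<equiv> 8 * (real k)\<^sup>2"
  defines "Q \<equiv> \<lambda>m. gauss_mmd (1 / (L * (L ^ m)\<^sup>2)) k x y"
  assumes k: "k > 0" and cost: "L ^ M < matching_cost k x y"
    and Q_nonneg: "\<And>m. 0 \<le> Q m" and Q_sum: "Q summable_on UNIV"
  shows "(real M - 4 * (real k)\<^sup>2) / 2 \<le> (\<Sum>\<^sub>\<infinity>m. Q m)"
proof -
  define Z where "Z = x ` {..<k} \<union> y ` {..<k}"
  define bad where "bad = {m :: nat. \<exists>u\<in>Z. \<exists>v\<in>Z. L ^ m < dist u v \<and> dist u v < L * L ^ m}"
  have "(real k)\<^sup>2 \<ge> 1"
    using k by simp
  then have L: "L > 1"
    by (simp add: L_def)
  have Z: "finite Z"
    by (simp add: Z_def)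
  have "card Z \<le> k + k"
    using card_Un_le[of "x ` {..<k}" "y ` {..<k}"] card_image_le[of "{..<k}" x] card_image_le[of "{..<k}" y]
    unfolding Z_def by simp
  then have "(card Z)\<^sup>2 \<le> (k + k)\<^sup>2"
    by (rule power_mono) simp
  also have "\<dots> = 4 * k\<^sup>2"
    by (simp add: power2_eq_square algebra_simps)
  finally have bad: "finite bad" "card bad \<le> 4 * k\<^sup>2"
    using card_distance_scales_le[OF Z L] unfolding bad_def by auto
  have "M \<le> card ({..<M} - bad) + card bad"
    using diff_card_le_card_Diff[OF bad(1), of "{..<M}"] by simp
  then have "real M \<le> real (card ({..<M} - bad) + 4 * k\<^sup>2)"
    using bad(2) by linarith
  then have "(real M - 4 * (real k)\<^sup>2) / 2 \<le> (\<Sum>m\<in>{..<M} - bad. 1 / 2)"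
    by simp
  also have "\<dots> \<le> (\<Sum>m\<in>{..<M} - bad. Q m)"
  proof (rule sum_mono)
    fix m assume m: "m \<in> {..<M} - bad"
    then have "L ^ m \<le> L ^ M"
      using L by (intro power_increasing) auto
    then have "L ^ m < matching_cost k x y"
      using cost by simp
    moreover have "dist u v \<le> L ^ m \<or> L * L ^ m \<le> dist u v" if "u \<in> Z" "v \<in> Z" for u v
      using m that unfolding bad_def by force
    ultimately show "1 / 2 \<le> Q m"
      unfolding Q_def L_def Z_def using k L by (intro gauss_mmd_ge_half) (auto simp: L_def)
  qed
  also have "\<dots> \<le> (\<Sum>\<^sub>\<infinity>m. Q m)"
    using Q_sum Q_nonneg by (intro finite_sum_le_infsum) auto
  finally show ?thesis .
qed

section \<open>Logarithmic control functions\<close>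

text \<open>With \<open>log L 0 = 0\<close> the logarithm alone is not monotone on
  \<open>{0..}\<close>, being negative on (0, 1). The cutoff together with \<open>c \<ge> 0\<close>
  makes the value at 0 equal to 0, the minimum.\<close>

lemma log_control_mono:
  fixes L c :: real
  assumes "L > 1" "c \<ge> 0"
  shows "mono_on {0..} (\<lambda>w. sqrt (max 0 ((log L w - c) / 2)))"
proof (rule mono_onI)
  fix r s :: real assume "r \<in> {0..}" "s \<in> {0..}" "r \<le> s"
  show "sqrt (max 0 ((log L r - c) / 2)) \<le> sqrt (max 0 ((log L s - c) / 2))"
  proof (cases "r = 0")
    case True
    then show ?thesis
      using assms(2) by (simp add: log_def max_def) \<comment> \<open>\<open>ln 0 = 0\<close>\<close>
  next
    case False
    then have "log L r \<le> log L s"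
      using \<open>r \<in> {0..}\<close> \<open>r \<le> s\<close> assms by simp
    then show ?thesis
      by (auto simp: max_def)
  qed
qed

text \<open>\<open>lower\<close> speaks of integer exponents \<open>M\<close>; rounding the
  logarithm costs at most 1, hence \<open>c + 1\<close> in the lower control function. Square roots
  appear because \<open>D\<close> is a squared distance.\<close>

lemma coarse_embedding_of_log_bound:
  fixes \<phi> :: "'x \<Rightarrow> 'y" and L :: real
  assumes maps: "\<phi> \<in> mspace X \<rightarrow> mspace Y" and L: "L > 1" and c: "c \<ge> 0" and a: "a \<ge> 0"
    and dist: "\<And>x y. x \<in> mspace X \<Longrightarrow> y \<in> mspace X \<Longrightarrow> mdist Y (\<phi> x) (\<phi> y) = sqrt (D x y)"
    and upper: "\<And>x y. x \<in> mspace X \<Longrightarrow> y \<in> mspace X \<Longrightarrow> D x y \<le> a * (mdist X x y)\<^sup>2"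
    and nonneg: "\<And>x y. x \<in> mspace X \<Longrightarrow> y \<in> mspace X \<Longrightarrow> 0 \<le> D x y"
    and lower: "\<And>x y M. x \<in> mspace X \<Longrightarrow> y \<in> mspace X \<Longrightarrow> L ^ M < mdist X x y \<Longrightarrow> (real M - c) / 2 \<le> D x y"
  shows "coarse_embedding X Y \<phi>"
  unfolding coarse_embedding_def
proof (intro conjI maps exI ballI)
  let ?m = "\<lambda>w. sqrt (max 0 ((log L w - (c + 1)) / 2))" and ?p = "\<lambda>w. sqrt a * w"
  show "?m \<in> {0..} \<rightarrow> {0..}" "?p \<in> {0..} \<rightarrow> {0..}"
    using a by auto
  show "mono_on {0..} ?m"
    using L c by (intro log_control_mono) auto
  show "mono_on {0..} ?p"
    using a by (intro mono_onI mult_left_mono) auto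
  show "filterlim ?m at_top at_top"
  proof -
    have "filterlim (\<lambda>w. (log L w - (c + 1)) / 2) at_top at_top"
    proof -
      have "filterlim (\<lambda>w. - ((c + 1) / 2) + (1 / (2 * ln L)) * ln w) at_top at_top"
        using L by (intro filterlim_tendsto_add_at_top[OF tendsto_const]
            filterlim_tendsto_pos_mult_at_top[OF tendsto_const] ln_at_top) simp
      moreover have "(\<lambda>w. - ((c + 1) / 2) + (1 / (2 * ln L)) * ln w) = (\<lambda>w. (log L w - (c + 1)) / 2)"
        by (simp add: log_def field_simps)
      ultimately show ?thesis
        by simp
    qed
    then have "filterlim (\<lambda>w. max 0 ((log L w - (c + 1)) / 2)) at_top at_top"
      by (rule filterlim_at_top_mono) auto
    then show ?thesis
      by (rule filterlim_compose[OF sqrt_at_top])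
  qed
  fix x y assume xy: "x \<in> mspace X" "y \<in> mspace X"
  have w: "mdist X x y \<ge> 0"
    by simp
  show "?m (mdist X x y) \<le> mdist Y (\<phi> x) (\<phi> y)"
    unfolding dist[OF xy]
  proof (intro real_sqrt_le_mono max.boundedI nonneg[OF xy])
    show "(log L (mdist X x y) - (c + 1)) / 2 \<le> D x y"
    proof (cases "mdist X x y > 1")
      case True
      \<comment> \<open>The largest integer strictly below the logarithm, as \<open>lower\<close>
        needs a strict inequality. The logarithm is positive, so \<open>nat\<close> truncates
        nothing.\<close>
      define M where "M = nat (\<lceil>log L (mdist X x y)\<rceil> - 1)"
      have "log L (mdist X x y) > 0"
        using True L by simp
      then have M: "real M < log L (mdist X x y)" "log L (mdist X x y) - 1 \<le> real M"
        unfolding M_def by linarith+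
      then have "L powr real M < mdist X x y"
        using L True by (simp add: less_log_iff)
      then have "(real M - c) / 2 \<le> D x y"
        using L xy by (intro lower) (simp_all add: powr_realpow)
      with M(2) show ?thesis
        by simp
    next
      case False
      have "log L (mdist X x y) \<le> 0"
      proof (cases "mdist X x y = 0")
        case True
        then show ?thesis
          by (simp add: log_def)
      next
        case False
        with w have "0 < mdist X x y"
          by linarith
        with \<open>\<not> 1 < mdist X x y\<close> L show ?thesis
          by simp
      qed
      then have "(log L (mdist X x y) - (c + 1)) / 2 \<le> 0"
        using c by simp
      with nonneg[OF xy] show ?thesis
        by linarith
    qed
  qed
  show "mdist Y (\<phi> x) (\<phi> y) \<le> ?p (mdist X x y)"
    using real_sqrt_le_mono[OF upper[OF xy]] w unfolding dist[OF xy] by (simp add: real_sqrt_mult)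
qed

section \<open>Assembling the embedding\<close>

text \<open>The vector \<open>v\<close> makes the type infinite, as the encoding needs. The features
  of all scales are placed side by side, which adds up the squared distances
  \<open>Q\<close>.\<close>

lemma coarse_embedding_empirical_l2:
  fixes v :: "'h::{real_inner, complete_space}"
  assumes k: "k > 0" and v: "v \<noteq> 0"
  shows "\<exists>\<phi> :: 'h pmf \<Rightarrow> 'h pmf \<Rightarrow> real.
    coarse_embedding (empirical_space k) (ip_metric l2_module l2_inner) \<phi>"
proof -
  define L where "L = 8 * (real k)\<^sup>2"
  define t where "t m = 1 / (L * (L ^ m)\<^sup>2)" for m
  have "(real k)\<^sup>2 \<ge> 1"
    using k by simp
  then have L: "L \<ge> 8"
    by (simp add: L_def)
  have t_nonneg: "t m \<ge> 0" for m
    using L by (simp add: t_def)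
  \<comment> \<open>Geometric decay makes the sum over the scales converge.\<close>
  have t_le: "t m \<le> (1 / 2) ^ m" for m
  proof -
    have "2 ^ m \<le> L ^ m" "1 \<le> L ^ m"
      using L by (auto intro: power_mono)
    then have "2 ^ m * 1 \<le> L ^ m * L ^ m"
      by (intro mult_mono) auto
    also have "\<dots> \<le> L * (L ^ m)\<^sup>2"
      using L mult_right_mono[of 1 L "(L ^ m)\<^sup>2"] by (simp add: power2_eq_square)
    finally have "t m \<le> 1 / 2 ^ m"
      unfolding t_def by (intro divide_left_mono) (use L in auto)
    then show ?thesis
      by (simp add: power_one_over)
  qed
  obtain B :: "'h set" where B: "\<And>x y. ((\<lambda>b. (x \<bullet> b) * (y \<bullet> b)) has_sum x \<bullet> y) B"
    by (rule exists_orthonormal_basis) blast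
  define J where "J = (SIGMA n:UNIV. {l. set l \<subseteq> B \<and> length l = n})"
  have \<Phi>: "((\<lambda>i. gauss_feature (t m) u i * gauss_feature (t m) w i)
      has_sum exp (- t m * (dist u w)\<^sup>2)) J" for m and u w :: 'h
    unfolding J_def by (intro has_sum_gauss_feature B t_nonneg)
  \<comment> \<open>The same choice of representatives as in \<open>wasserstein1\<close>, so that
    \<open>W\<close> is the distance by definition.\<close>
  define tup :: "'h pmf \<Rightarrow> nat \<Rightarrow> 'h" where "tup \<alpha> = (SOME x. empirical k x = \<alpha>)" for \<alpha>
  define W where "W \<alpha> \<beta> = matching_cost k (tup \<alpha>) (tup \<beta>)" for \<alpha> \<beta>
  have W: "mdist (empirical_space k) = W"
    by (intro ext) (simp add: mdist_empirical_space k W_def tup_def wasserstein1_def)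
  define Q where "Q \<alpha> \<beta> m = gauss_mmd (t m) k (tup \<alpha>) (tup \<beta>)" for \<alpha> \<beta> m
  define D where "D \<alpha> \<beta> = (\<Sum>\<^sub>\<infinity>m. Q \<alpha> \<beta> m)" for \<alpha> \<beta>
  define \<psi> where "\<psi> \<alpha> = (\<lambda>(m, i). \<Sum>j<k. gauss_feature (t m) (tup \<alpha> j) i)" for \<alpha>
  have level: "((\<lambda>i. (\<psi> \<alpha> (m, i) - \<psi> \<beta> (m, i))\<^sup>2) has_sum Q \<alpha> \<beta> m) J" for \<alpha> \<beta> m
    unfolding \<psi>_def Q_def prod.case by (rule has_sum_gauss_mmd[OF \<Phi>])
  have Q_nonneg: "0 \<le> Q \<alpha> \<beta> m" for \<alpha> \<beta> m
    by (rule has_sum_nonneg[OF level]) simp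
  have Q_le: "Q \<alpha> \<beta> m \<le> 2 * real k ^ 3 * (W \<alpha> \<beta>)\<^sup>2 * (1 / 2) ^ m" for \<alpha> \<beta> m
  proof -
    have "Q \<alpha> \<beta> m \<le> 2 * t m * real k ^ 3 * (W \<alpha> \<beta>)\<^sup>2"
      unfolding Q_def W_def by (rule gauss_mmd_le[OF \<Phi> k t_nonneg])
    also have "\<dots> = 2 * real k ^ 3 * (W \<alpha> \<beta>)\<^sup>2 * t m"
      by (simp only: mult_ac)
    also have "\<dots> \<le> 2 * real k ^ 3 * (W \<alpha> \<beta>)\<^sup>2 * (1 / 2) ^ m"
      by (intro mult_left_mono t_le) simp
    finally show ?thesis .
  qed
  have "(\<lambda>m. (1 / 2) ^ m) sums (2 :: real)"
    using geometric_sums[of "1 / 2 :: real"] by simp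
  then have "((\<lambda>m. (1 / 2 :: real) ^ m) has_sum 2) UNIV"
    by (rule sums_nonneg_imp_has_sum) simp
  then have bound: "((\<lambda>m. 2 * real k ^ 3 * (W \<alpha> \<beta>)\<^sup>2 * (1 / 2) ^ m)
      has_sum 2 * real k ^ 3 * (W \<alpha> \<beta>)\<^sup>2 * 2) UNIV" for \<alpha> \<beta>
    by (rule has_sum_cmult_right)
  have Q_sum: "Q \<alpha> \<beta> summable_on UNIV" for \<alpha> \<beta>
    by (rule summable_on_comparison_test[OF has_sum_imp_summable[OF bound]]) (rule Q_le Q_nonneg)+
  have Q_D: "(Q \<alpha> \<beta> has_sum D \<alpha> \<beta>) UNIV" for \<alpha> \<beta>
    unfolding D_def by (rule has_sum_infsum[OF Q_sum])
  have total: "((\<lambda>z. (\<psi> \<alpha> z - \<psi> \<beta> z)\<^sup>2) has_sum D \<alpha> \<beta>) (UNIV \<times> J)" for \<alpha> \<beta>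
  proof (rule has_sum_SigmaI[OF level Q_D])
    show "(\<lambda>z. (\<psi> \<alpha> z - \<psi> \<beta> z)\<^sup>2) summable_on UNIV \<times> J"
      by (rule summable_on_SigmaI[OF level Q_sum]) simp
  qed
  obtain \<iota> :: "nat \<times> nat \<times> 'h list \<Rightarrow> 'h" where \<iota>: "inj_on \<iota> {(m, n, l). length l = n}"
    using exists_list_encoding[OF infinite_UNIV_real_vector[OF v]] .
  \<comment> \<open>Point masses carry the indices from \<open>'h\<close> to \<open>'h pmf\<close>,
    the index type in the theorem.\<close>
  have "inj_on (return_pmf \<circ> \<iota>) (UNIV \<times> J)"
    using \<iota> by (intro comp_inj_on inj_on_subset[OF \<iota>]) (auto simp: J_def inj_on_def)
  from l2_embedding_of_features[where D = D, OF this total]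
  obtain \<phi> :: "'h pmf \<Rightarrow> 'h pmf \<Rightarrow> real" where
    maps: "\<And>\<alpha>. \<phi> \<alpha> \<in> carrier l2_module" and
    dist: "\<And>\<alpha> \<beta>. mdist (ip_metric l2_module l2_inner) (\<phi> \<alpha>) (\<phi> \<beta>) = sqrt (D \<alpha> \<beta>)"
    by blast
  \<comment> \<open>Here \<open>c\<close> bounds the number of spoilt scales, and \<open>a\<close>
    is the \<open>2 * k^3\<close> of \<open>Q_le\<close> times the geometric sum 2.\<close>
  have "coarse_embedding (empirical_space k) (ip_metric l2_module l2_inner) \<phi>"
  proof (rule coarse_embedding_of_log_bound[where L = L and c = "4 * (real k)\<^sup>2" and a = "4 * real k ^ 3" and D = D])
    show "D \<alpha> \<beta> \<le> 4 * real k ^ 3 * (mdist (empirical_space k) \<alpha> \<beta>)\<^sup>2" for \<alpha> \<beta>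
      using has_sum_mono[OF Q_D bound Q_le, of \<alpha> \<beta>] by (simp add: W)
    show "0 \<le> D \<alpha> \<beta>" for \<alpha> \<beta>
      unfolding D_def by (intro infsum_nonneg Q_nonneg)
    show "(real M - 4 * (real k)\<^sup>2) / 2 \<le> D \<alpha> \<beta>"
      if "L ^ M < mdist (empirical_space k) \<alpha> \<beta>" for \<alpha> \<beta> M
      using gauss_mmd_scale_sum_ge[OF k, of M "tup \<alpha>" "tup \<beta>"] Q_nonneg[of \<alpha> \<beta>] Q_sum[of \<alpha> \<beta>] that
      unfolding W W_def D_def Q_def t_def L_def by simp
  qed (use L maps dist in \<open>auto simp: mspace_l2 simp del: l2_module_simps\<close>)
  then show ?thesis
    by (rule exI[of _ \<phi>])
qed

text \<open>In the zero space all tuples coincide, so every distance is 0 and the identity serves as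
  both control functions.\<close>

lemma coarse_embedding_empirical_trivial:
  assumes k: "k > 0" and trivial: "\<And>v :: 'h::{real_inner, complete_space}. v = 0"
  shows "coarse_embedding (empirical_space k :: 'h pmf metric)
    (ip_metric l2_module l2_inner) (\<lambda>_ (_ :: 'h pmf). 0 :: real)"
proof -
  have zero: "(\<lambda>_ :: 'h pmf. 0) \<in> carrier l2_module"
    by simp
  have "matching_cost k x y = 0" for x y :: "nat \<Rightarrow> 'h"
  proof -
    have "x i = y i" for i
      using trivial[of "x i"] trivial[of "y i"] by simp
    then have "x = y" ..
    then show ?thesis
      using k by (simp add: matching_cost_eq_0_iff)
  qed
  then have "mdist (empirical_space k) \<alpha> \<beta> = 0" for \<alpha> \<beta> :: "'h pmf"
    by (simp add: mdist_empirical_space k wasserstein1_def)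
  moreover have "mdist (ip_metric l2_module l2_inner) (\<lambda>_ :: 'h pmf. 0) (\<lambda>_. 0) = 0"
    using mdist_l2[OF zero zero] by simp
  moreover have "(\<lambda>_ (_ :: 'h pmf). 0 :: real) \<in> X \<rightarrow> mspace (ip_metric l2_module l2_inner)" for X :: "'h pmf set"
    using zero unfolding mspace_l2 by simp
  ultimately show ?thesis
    unfolding coarse_embedding_def
    by (intro conjI exI[of _ "\<lambda>w. w"]) (simp_all add: monotone_on_def filterlim_ident del: mdist_zero)
qed

theorem theorem7:
  fixes k :: nat
  assumes "k > 0"
  shows "\<exists>(H' :: (real, 'h::{real_inner, complete_space} pmf \<Rightarrow> real) module) ip \<phi>.
           real_hilbert_space H' ip \<and>
           coarse_embedding (empirical_space k :: 'h pmf metric) (ip_metric H' ip) \<phi>"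
proof -
  \<comment> \<open>The zero space is treated apart: its type has one element and cannot encode
    infinitely many coordinates.\<close>
  have "\<exists>\<phi>. coarse_embedding (empirical_space k :: 'h pmf metric)
      (ip_metric (l2_module :: (real, 'h pmf \<Rightarrow> real) module) l2_inner) \<phi>"
  proof (cases "\<exists>v :: 'h. v \<noteq> 0")
    case True
    then show ?thesis
      using coarse_embedding_empirical_l2[OF assms] by blast
  next
    case False
    then show ?thesis
      using coarse_embedding_empirical_trivial[OF assms] by blast
  qed
  then show ?thesis
    using real_hilbert_space_l2 by blast
qed

end
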